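(* Let $[a,b]\in\mathcal{G}_V$, i.e. $a=(a_i)_{i\in\tilde V}\in(0,\infty)^{\tilde V}$ and $b=(b_i)_{i\in\tilde V}\in\mathbb{R}^{\tilde V}$ with $a_\delta=1$, $b_\delta=0$. The image measure $\mathscr{S}_{[a,b]}\mu^{W^a}$ of $\mu^{W^a}$ under the map $\mathscr{S}_{[a,b]}$ is absolutely continuous with respect to $\mu^W$ with the following Radon–Nikodym derivative on $\Omega_V$: $$\frac{d(\mathscr{S}_{[a,b]}\mu^{W^a})}{d\mu^W}(u,s)=\mathcal{L}^W(a,b)^{-1}\exp\Big(-\sum_{i\in V}(a_i^2+b_i^2-1)\beta_i^W(u)-\sum_{i\in V}b_i\theta_i^W(u,s)\Big)$$ with the constant $$\mathcal{L}^W(a,b):=\prod_{(i\sim j)\in\tilde E}e^{-W_{ij}(a_ia_j+b_ib_j-1)}\cdot\prod_{j\in V}\frac1{a_j}.$$ In other words, for any measurable function $f:\Omega_V\to[0,\infty)$, $$\mathbb{E}_{\mu^W}\Big[f(u,s)\,e^{-\sum_{i\in V}(a_i^2+b_i^2-1)\beta_i^W(u)-\sum_{i\in V}b_i\theta_i^W(u,s)}\Big]=\mathcal{L}^W(a,b)\,\mathbb{E}_{\mu^{W^a}}[f\circ\mathscr{S}_{[a,b]}].$$ In particular, $\mathcal{L}^W$ describes the joint Laplace transform of $\beta^W$ and $\theta^W$: $$\mathcal{L}^W(a,b)=\mathbb{E}_{\mu^W}\Big[e^{-\sum_{i\in V}(a_i^2+b_i^2-1)\beta_i^W(u)-\sum_{i\in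 V}b_i\theta_i^W(u,s)}\Big].$$
   Context: $\tilde G=(\tilde V,\tilde E)$ is a finite connected undirected graph without loops and without parallel edges; $i\sim j$ means that $\{i,j\}$ is an edge. $\delta\in\tilde V$ is a distinguished vertex and $V=\tilde V\setminus\{\delta\}$. Weights: $W_{ij}=W_{ji}>0$ if $i\sim j$, and $W_{ij}=0$ otherwise. Sums and products over $(i\sim j)\in\tilde E$ run over undirected edges, each counted once. $\Omega_V=\{(u,s)\in\mathbb{R}^{\tilde V}\times\mathbb{R}^{\tilde V}:u_\delta=0,\ s_\delta=0\}$. The matrix $A^W(u)\in\mathbb{R}^{\tilde V\times\tilde V}$ has entries $A^W_{ij}(u)=-W_{ij}e^{u_i+u_j}$ for $i\ne j$ and $A^W_{ii}(u)=\sum_{k\in\tilde V}W_{ik}e^{u_i+u_k}$; $A^W_{VV}(u)$ is its restriction to $V\times V$. $\rho^W(u,s)=\det A^W_{VV}(u)\prod_{(i\sim j)\in\tilde E}e^{-W_{ij}[\cosh(u_i-u_j)-1+\frac12(s_i-s_j)^2e^{u_i+u_j}]}$. $\mu^W$ is the probability measure on $\Omega_V$ given by $\mu^W(du\,ds)=\rho^W(u,s)\prod_{i\in V}\frac{1}{2\pi}e^{-u_i}\,du_i\,ds_i$ (with Dirac mass at $(u_\delta,s_\delta)=(0,0)$); $\mathbb{E}_{\mu^W}$ is its expectation. Random variables, for $i\in V$: $\beta_i^W(u)=\frac12\sum_{j\in\tilde V}W_{ij}e^{u_j-u_i}$ and $\theta_i^W(u,s)=\sum_{j\in\tilde V}W_{ij}e^{u_j}(s_i-s_j)$.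 $\mathcal{G}_V$ is the set of $[a,b]=([a_i,b_i])_{i\in\tilde V}$ with $a_i>0$, $b_i\in\mathbb{R}$, $[a_\delta,b_\delta]=[1,0]$. The scaling map is $\mathscr{S}_{[a,b]}:\Omega_V\to\Omega_V$, $\mathscr{S}_{[a,b]}(u,s)=(u_i+\log a_i,\ s_i-e^{-u_i}b_i/a_i)_{i\in\tilde V}$. Rescaled weights: $W^a_{ij}=a_ia_jW_{ij}$. *)

theory Defs
  imports "HOL-Probability.Probability"
begin

text \<open>
  The vertex set of the graph is the whole finite type \<open>'v\<close> (this is the set written with a tilde
  in the mathematical text), \<open>\<delta> :: 'v\<close> is the distinguished vertex, and the set of the
  remaining vertices is \<open>UNIV - {\<delta>}\<close>.  An undirected edge is the set of its two endpoints.
\<close>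

definition simple_graph :: "'v set set \<Rightarrow> bool" where
  "simple_graph E \<longleftrightarrow> (\<forall>e\<in>E. card e = 2)"

definition connected_graph :: "'v set set \<Rightarrow> bool" where
  "connected_graph E \<longleftrightarrow> (\<forall>i j. (i, j) \<in> {(x, y). {x, y} \<in> E}\<^sup>*)"

definition edge_weights :: "'v set set \<Rightarrow> ('v \<Rightarrow> 'v \<Rightarrow> real) \<Rightarrow> bool" where
  "edge_weights E W \<longleftrightarrow>
     (\<forall>i j. W i j = W j i) \<and>
     (\<forall>i j. if {i, j} \<in> E then W i j > 0 else W i j = 0)"

text \<open>
  \<open>on_edge f e\<close> is the value \<open>f i j\<close> for \<open>e = {i, j}\<close>.  It is only used for symmetric \<open>f\<close>, where the
  choice of the orientation is irrelevant.
\<close>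

definition on_edge :: "('v \<Rightarrow> 'v \<Rightarrow> 'b) \<Rightarrow> 'v set \<Rightarrow> 'b" where
  "on_edge f e = (THE c. \<exists>i j. e = {i, j} \<and> c = f i j)"

lemma on_edge_eq:
  assumes "\<And>i j. f i j = f j i"
  shows "on_edge f {i, j} = f i j"
  unfolding on_edge_def using assms by (intro the_equality) (auto simp: doubleton_eq_iff)

text \<open>
  The determinant of a submatrix indexed by a finite set \<open>S\<close>: the library's Leibniz formula
  \<open>det_def\<close> with the index type replaced by \<open>S\<close>.
\<close>

definition det_on :: "'v set \<Rightarrow> ('v \<Rightarrow> 'v \<Rightarrow> real) \<Rightarrow> real" where
  "det_on S A = (\<Sum>p | p permutes S. of_int (sign p) * (\<Prod>i\<in>S. A i (p i)))"

lemma det_on_UNIV: "det_on (UNIV :: 'v::finite set) A = det (\<chi> i j. A i j)"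
  by (simp add: det_on_def det_def)

definition Omega :: "'v \<Rightarrow> (('v \<Rightarrow> real) \<times> ('v \<Rightarrow> real)) set" where
  "Omega \<delta> = {(u, s). u \<delta> = 0 \<and> s \<delta> = 0}"

definition A_mat :: "('v::finite \<Rightarrow> 'v \<Rightarrow> real) \<Rightarrow> ('v \<Rightarrow> real) \<Rightarrow> 'v \<Rightarrow> 'v \<Rightarrow> real" where
  "A_mat W u i j =
     (if i = j then \<Sum>k\<in>UNIV. W i k * exp (u i + u k) else - W i j * exp (u i + u j))"

definition rho :: "'v::finite set set \<Rightarrow> 'v \<Rightarrow> ('v \<Rightarrow> 'v \<Rightarrow> real) \<Rightarrow>
    ('v \<Rightarrow> real) \<times> ('v \<Rightarrow> real) \<Rightarrow> real" where
  "rho E \<delta> W = (\<lambda>(u, s).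
     det_on (UNIV - {\<delta>}) (A_mat W u) *
     (\<Prod>e\<in>E. on_edge (\<lambda>i j.
        exp (- W i j * (cosh (u i - u j) - 1 + 1/2 * (s i - s j)\<^sup>2 * exp (u i + u j)))) e))"

text \<open>
  Lebesgue measure in the coordinates other than \<open>\<delta>\<close>, Dirac mass at 0 in the coordinate \<open>\<delta>\<close>.
\<close>

definition pinned_lborel :: "'v::finite \<Rightarrow> ('v \<Rightarrow> real) measure" where
  "pinned_lborel \<delta> = (\<Pi>\<^sub>M i\<in>UNIV. if i = \<delta> then return borel 0 else lborel)"

text \<open>
  The coercion \<open>ennreal\<close> cuts off negative values, but the density is nonnegative because
  \<open>A_mat W u\<close> is positive semidefinite for nonnegative symmetric weights.
\<close>

definition mu :: "'v::finite set set \<Rightarrow> 'v \<Rightarrow> ('v \<Rightarrow> 'v \<Rightarrow> real) \<Rightarrow>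
    (('v \<Rightarrow> real) \<times> ('v \<Rightarrow> real)) measure" where
  "mu E \<delta> W = restrict_space
     (density (pinned_lborel \<delta> \<Otimes>\<^sub>M pinned_lborel \<delta>)
        (\<lambda>(u, s). ennreal (rho E \<delta> W (u, s) * (\<Prod>i\<in>UNIV - {\<delta>}. 1 / (2 * pi) * exp (- u i)))))
     (Omega \<delta>)"

abbreviation Omega_borel :: "'v::finite \<Rightarrow> (('v \<Rightarrow> real) \<times> ('v \<Rightarrow> real)) measure" where
  "Omega_borel \<delta> \<equiv> restrict_space borel (Omega \<delta>)"

lemma sets_pinned_lborel: "sets (pinned_lborel \<delta>) = sets borel"
proof -
  have "sets (pinned_lborel \<delta>) = sets (\<Pi>\<^sub>M i\<in>UNIV. (borel :: real measure))"
    unfolding pinned_lborel_def by (intro sets_PiM_cong) auto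
  then show ?thesis by (simp add: sets_PiM_equal_borel)
qed

lemma sets_mu: "sets (mu E \<delta> W) = sets (Omega_borel \<delta>)"
proof -
  have "sets (pinned_lborel \<delta> \<Otimes>\<^sub>M pinned_lborel \<delta>) =
        sets ((borel :: ('a \<Rightarrow> real) measure) \<Otimes>\<^sub>M (borel :: ('a \<Rightarrow> real) measure))"
    by (intro sets_pair_measure_cong sets_pinned_lborel)
  also have "(borel :: ('a \<Rightarrow> real) measure) \<Otimes>\<^sub>M (borel :: ('a \<Rightarrow> real) measure) = borel"
    by (rule borel_prod)
  finally show ?thesis
    unfolding mu_def by (intro sets_restrict_space_cong) (simp only: sets_density)
qed

lemma space_mu: "space (mu E \<delta> W) = Omega \<delta>"
  using sets_eq_imp_space_eq[OF sets_mu, of E \<delta> W] by (simp add: space_restrict_space)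

definition beta :: "('v::finite \<Rightarrow> 'v \<Rightarrow> real) \<Rightarrow> ('v \<Rightarrow> real) \<Rightarrow> 'v \<Rightarrow> real" where
  "beta W u i = 1/2 * (\<Sum>j\<in>UNIV. W i j * exp (u j - u i))"

definition theta :: "('v::finite \<Rightarrow> 'v \<Rightarrow> real) \<Rightarrow> ('v \<Rightarrow> real) \<Rightarrow> ('v \<Rightarrow> real) \<Rightarrow> 'v \<Rightarrow> real" where
  "theta W u s i = (\<Sum>j\<in>UNIV. W i j * exp (u j) * (s i - s j))"

definition G_set :: "'v \<Rightarrow> (('v \<Rightarrow> real) \<times> ('v \<Rightarrow> real)) set" where
  "G_set \<delta> = {(a, b). (\<forall>i. 0 < a i) \<and> a \<delta> = 1 \<and> b \<delta> = 0}"

definition scaling :: "('v \<Rightarrow> real) \<Rightarrow> ('v \<Rightarrow> real) \<Rightarrow>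
    ('v \<Rightarrow> real) \<times> ('v \<Rightarrow> real) \<Rightarrow> ('v \<Rightarrow> real) \<times> ('v \<Rightarrow> real)" where
  "scaling a b = (\<lambda>(u, s). (\<lambda>i. u i + ln (a i), \<lambda>i. s i - exp (- u i) * b i / a i))"

definition rescale :: "('v \<Rightarrow> real) \<Rightarrow> ('v \<Rightarrow> 'v \<Rightarrow> real) \<Rightarrow> 'v \<Rightarrow> 'v \<Rightarrow> real" where
  "rescale a W i j = a i * a j * W i j"

definition laplace_weight :: "'v::finite \<Rightarrow> ('v \<Rightarrow> 'v \<Rightarrow> real) \<Rightarrow> ('v \<Rightarrow> real) \<Rightarrow> ('v \<Rightarrow> real) \<Rightarrow>
    ('v \<Rightarrow> real) \<times> ('v \<Rightarrow> real) \<Rightarrow> real" where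
  "laplace_weight \<delta> W a b = (\<lambda>(u, s).
     exp (- (\<Sum>i\<in>UNIV - {\<delta>}. ((a i)\<^sup>2 + (b i)\<^sup>2 - 1) * beta W u i)
          - (\<Sum>i\<in>UNIV - {\<delta>}. b i * theta W u s i)))"

definition laplace_const :: "'v::finite set set \<Rightarrow> 'v \<Rightarrow> ('v \<Rightarrow> 'v \<Rightarrow> real) \<Rightarrow>
    ('v \<Rightarrow> real) \<Rightarrow> ('v \<Rightarrow> real) \<Rightarrow> real" where
  "laplace_const E \<delta> W a b =
     (\<Prod>e\<in>E. on_edge (\<lambda>i j. exp (- W i j * (a i * a j + b i * b j - 1))) e) *
     (\<Prod>j\<in>UNIV - {\<delta>}. 1 / a j)"

end

theory Submission imports Defs begin

text \<open>
  The statement has two parts of different nature.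

  The first part is a change of variables.  The scaling map is a translation in \<open>u\<close>, followed by a
  translation in \<open>s\<close> that depends on \<open>u\<close>, and so it preserves Lebesgue measure.  Under it, the
  conductances \<open>W i j * exp (u i + u j)\<close> for the weights \<open>W\<close> correspond to those for the rescaled
  weights.  Consequently the determinant does not change, and the energy changes by terms that are
  linear in \<open>beta\<close> and \<open>theta\<close>, plus a constant (\<open>field_density_unscale\<close>).  This
  gives the identity of measures (\<open>nn_integral_mu_scaling\<close>).

  The second part is that \<open>mu\<close> has total mass 1, for all weights on a connected graph
  (\<open>nn_integral_field_density\<close>).  Only with this, applied to the rescaled weights, is
  \<open>laplace_const\<close> the value of the Laplace transform.  The proof is an induction on the number of
  vertices that removes one vertex \<open>v\<close> at a time.  Put
  \<open>y = (\<Sum>k. W v k * exp (u k - u v)) = 2 * beta W u v\<close>.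

  \<^item> Taking the Schur complement of the determinant at \<open>v\<close> yields the pivot
    \<open>y * (exp (u v))\<^sup>2\<close> and the determinant of the smaller graph with the weights
    \<open>W i j + W v i * W v j / y\<close> (\<open>det_laplacian_eliminate\<close>).
  \<^item> Completing the square in \<open>s v\<close>, and expressing \<open>u v\<close> by \<open>y\<close> in the terms with \<open>cosh\<close>,
    turns the energy into the energy of the smaller graph with the same new weights, up to terms in
    \<open>y\<close> and a Gaussian in \<open>s v\<close> (\<open>energy_eliminate\<close>).
  \<^item> After integration over \<open>s v\<close> and passage from \<open>u v\<close> to \<open>ln y\<close>, what remains is the density of the smaller
    graph times a function of \<open>y\<close> alone, whose integral is 1 (\<open>nn_integral_elim_factor\<close>).

  Since the new weights depend on \<open>y\<close> but not otherwise on the fields, integrating \<open>y\<close> last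
  completes the induction.
\<close>

section \<open>Schur complements of determinants\<close>

lemma det_on_insert_row:
  assumes "finite T" "v \<notin> T" "\<And>j. j \<in> T \<Longrightarrow> A v j = 0"
  shows "det_on (insert v T) A = A v v * det_on T A"
proof -
  have "det_on (insert v T) A =
      (\<Sum>p | p permutes T. of_int (sign p) * (\<Prod>i\<in>insert v T. A i (p i)))"
    unfolding det_on_def
  proof (rule sum.mono_neutral_right)
    show "finite {p. p permutes insert v T}" using assms(1) by (simp add: finite_permutations)
    show "{p. p permutes T} \<subseteq> {p. p permutes insert v T}" by (auto intro: permutes_subset)
    show "\<forall>p\<in>{p. p permutes insert v T} - {p. p permutes T}.
        of_int (sign p) * (\<Prod>i\<in>insert v T. A i (p i)) = 0"
    proof
      fix p assume "p \<in> {p. p permutes insert v T} - {p. p permutes T}"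
      then have p: "p permutes insert v T" "\<not> p permutes T" by auto
      have "p v \<noteq> v"
      proof
        assume "p v = v"
        then have "p permutes T"
          using p(1) by (intro permutes_superset[OF p(1)]) auto
        with p show False by simp
      qed
      moreover have "p v \<in> insert v T" using permutes_in_image[OF p(1), of v] by blast
      ultimately have "A v (p v) = 0" using assms(3) by auto
      then show "of_int (sign p) * (\<Prod>i\<in>insert v T. A i (p i)) = 0"
        using assms by simp
    qed
  qed
  also have "\<dots> = (\<Sum>p | p permutes T. A v v * (of_int (sign p) * (\<Prod>i\<in>T. A i (p i))))"
  proof (rule sum.cong)
    fix p assume "p \<in> {p. p permutes T}"
    then have "p v = v" using assms(2) by (simp add: permutes_not_in)
    then show "of_int (sign p) * (\<Prod>i\<in>insert v T. A i (p i)) =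
        A v v * (of_int (sign p) * (\<Prod>i\<in>T. A i (p i)))" using assms by simp
  qed simp
  finally show ?thesis by (simp add: det_on_def sum_distrib_left)
qed

lemma det_on_cong:
  assumes "\<And>i j. i \<in> S \<Longrightarrow> j \<in> S \<Longrightarrow> A i j = B i j"
  shows "det_on S A = det_on S B"
  unfolding det_on_def using assms
  by (intro sum.cong refl arg_cong2[where f="(*)"] prod.cong) (auto simp: permutes_in_image)

lemma det_on_empty: "det_on {} A = 1"
  by (simp add: det_on_def)

text \<open>
  Padding by the identity turns \<open>det_on S\<close> into a determinant of a genuine matrix, to which
  multiplicativity and invariance under transposition apply.
\<close>

lemma det_on_extend_identity:
  fixes S :: "'v::finite set"
  shows "det_on UNIV (\<lambda>i j. if i \<in> S then A i j else of_bool (i = j)) = det_on S A"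
proof -
  let ?B = "\<lambda>i j. if i \<in> S then A i j else of_bool (i = j)"
  have "det_on (T \<union> S) ?B = det_on S A" if "T \<inter> S = {}" for T
    using finite[of T] that
  proof (induction T)
    case empty
    then show ?case by (auto intro!: det_on_cong)
  next
    case (insert x T)
    then have "det_on (insert x (T \<union> S)) ?B = ?B x x * det_on (T \<union> S) ?B"
      by (intro det_on_insert_row) auto
    with insert show ?case by simp
  qed
  from this[of "- S"] show ?thesis by (simp add: Compl_partition2)
qed

text \<open>
  Adding multiples of column \<open>v\<close> to the other columns clears row \<open>v\<close> and leaves the Schur
  complement in the remaining block.  The column operations form a unitriangular matrix \<open>?R\<close>;
  the transpose of \<open>?R\<close> has row \<open>v\<close> equal to a unit vector, so that \<open>det_on_insert_row\<close> shows
  that its determinant is 1.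
\<close>

lemma det_on_schur_complement:
  fixes T :: "'v::finite set"
  assumes v: "v \<notin> T" and nz: "A v v \<noteq> 0"
  shows "det_on (insert v T) A = A v v * det_on T (\<lambda>i j. A i j - A i v * A v j / A v v)"
proof -
  let ?S = "insert v T"
  let ?B = "\<lambda>i j. if i \<in> ?S then A i j else of_bool (i = j)"
  let ?R = "\<lambda>i j. of_bool (i = j) - of_bool (i = v \<and> j \<in> T) * (A v j / A v v)"
  let ?C = "\<lambda>i j. A i j - of_bool (j \<in> T) * (A i v * A v j / A v v)"
  have "det_on UNIV (\<lambda>i j. ?R j i) = det_on (insert v (- {v})) (\<lambda>i j. ?R j i)"
    by (rule arg_cong2[where f=det_on]) auto
  also have "\<dots> = ?R v v * det_on (- {v}) (\<lambda>i j. ?R j i)"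
    using v by (intro det_on_insert_row) auto
  also have "det_on (- {v}) (\<lambda>i j. ?R j i) = det_on (- {v}) (\<lambda>i j. of_bool (i = j))"
    by (intro det_on_cong) auto
  also have "\<dots> = det_on UNIV (\<lambda>i j. if i \<in> - {v} then of_bool (i = j) else of_bool (i = j))"
    by (rule det_on_extend_identity[symmetric])
  also have "\<dots> = det_on ({} :: 'v set) (\<lambda>i j. 0)"
    using det_on_extend_identity[of "{} :: 'v set" "\<lambda>i j. 0"] by simp
  finally have detR: "det_on UNIV (\<lambda>i j. ?R j i) = 1" using v by (simp add: det_on_empty)
  have tr: "transpose (\<chi> i j. ?R j i) = (\<chi> i j. ?R i j)" by (simp add: transpose_def)
  have R1: "det (\<chi> i j. ?R i j) = 1"
    using det_transpose[of "\<chi> i j. ?R j i"] detR unfolding det_on_UNIV tr by simp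
  have mult: "(\<chi> i j. ?B i j) ** (\<chi> i j. ?R i j) =
      (\<chi> i j. if i \<in> ?S then ?C i j else of_bool (i = j))"
  proof -
    have "(\<Sum>k\<in>UNIV. ?B i k * ?R k j) = (if i \<in> ?S then ?C i j else of_bool (i = j))" for i j
    proof -
      have "(\<Sum>k\<in>UNIV. ?B i k * ?R k j) =
          (\<Sum>k\<in>UNIV. (if k = j then ?B i k else 0)
             - (if k = v then ?B i k * of_bool (j \<in> T) * (A v j / A v v) else 0))"
        by (intro sum.cong) (auto simp: algebra_simps)
      also have "\<dots> = ?B i j - ?B i v * of_bool (j \<in> T) * (A v j / A v v)"
        by (simp add: sum_subtractf)
      finally show ?thesis by auto
    qed
    then show ?thesis by (simp add: matrix_matrix_mult_def)
  qed
  have "det_on ?S A = det_on UNIV ?B" by (rule det_on_extend_identity[symmetric])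
  also have "\<dots> = det ((\<chi> i j. ?B i j) ** (\<chi> i j. ?R i j))"
    by (simp only: det_mul R1 det_on_UNIV mult_1_right)
  also have "\<dots> = det_on UNIV (\<lambda>i j. if i \<in> ?S then ?C i j else of_bool (i = j))"
    unfolding mult by (rule det_on_UNIV[symmetric])
  also have "\<dots> = det_on ?S ?C" by (rule det_on_extend_identity)
  also have "\<dots> = ?C v v * det_on T ?C"
    using v nz by (intro det_on_insert_row) auto
  also have "det_on T ?C = det_on T (\<lambda>i j. A i j - A i v * A v j / A v v)"
    by (intro det_on_cong) auto
  finally show ?thesis using v by simp
qed

section \<open>Sums and products over edges\<close>

text \<open>
  Every edge \<open>{i, j}\<close> arises from exactly the two ordered pairs \<open>(i, j)\<close> and \<open>(j, i)\<close>,
  which are distinct because the graph has no loops.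
\<close>

lemma sum_on_edge:
  fixes f :: "'v::finite \<Rightarrow> 'v \<Rightarrow> real"
  assumes E: "simple_graph E" and sym: "\<And>i j. f i j = f j i"
    and zero: "\<And>i j. {i, j} \<notin> E \<Longrightarrow> f i j = 0"
  shows "(\<Sum>e\<in>E. on_edge f e) = 1/2 * (\<Sum>i\<in>UNIV. \<Sum>j\<in>UNIV. f i j)"
proof -
  let ?P = "{(i, j). {i, j} \<in> E}"
  have "(\<Sum>i\<in>UNIV. \<Sum>j\<in>UNIV. f i j) = (\<Sum>(i, j)\<in>UNIV. f i j)"
    by (simp add: sum.cartesian_product)
  also have "\<dots> = (\<Sum>(i, j)\<in>?P. f i j)"
    using zero by (intro sum.mono_neutral_right) auto
  also have "\<dots> = (\<Sum>e\<in>E. \<Sum>(i, j)\<in>{p \<in> ?P. (\<lambda>(i, j). {i, j}) p = e}. f i j)"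
    by (rule sum.group[symmetric]) auto
  also have "\<dots> = (\<Sum>e\<in>E. 2 * on_edge f e)"
  proof (rule sum.cong)
    fix e assume e: "e \<in> E"
    then obtain i j where ij: "e = {i, j}" "i \<noteq> j"
      using E by (auto simp: simple_graph_def card_2_iff)
    have "{p \<in> ?P. (\<lambda>(i, j). {i, j}) p = e} = {(i, j), (j, i)}"
      using e ij by (auto simp: doubleton_eq_iff insert_commute)
    then show "(\<Sum>(i, j)\<in>{p \<in> ?P. (\<lambda>(i, j). {i, j}) p = e}. f i j) = 2 * on_edge f e"
      using ij sym on_edge_eq[of f i j] by simp
  qed simp
  finally show ?thesis by (simp add: sum_distrib_left[symmetric])
qed

lemma prod_on_edge_exp:
  fixes f :: "'v::finite \<Rightarrow> 'v \<Rightarrow> real"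
  assumes E: "simple_graph E" and sym: "\<And>i j. f i j = f j i"
    and zero: "\<And>i j. {i, j} \<notin> E \<Longrightarrow> f i j = 0"
  shows "(\<Prod>e\<in>E. on_edge (\<lambda>i j. exp (f i j)) e) = exp (1/2 * (\<Sum>i\<in>UNIV. \<Sum>j\<in>UNIV. f i j))"
proof -
  have "on_edge (\<lambda>i j. exp (f i j)) e = exp (on_edge f e)" if "e \<in> E" for e
  proof -
    have "card e = 2" using E that by (simp add: simple_graph_def)
    then obtain i j where "e = {i, j}" by (auto simp: card_2_iff)
    then show ?thesis using sym by (simp add: on_edge_eq)
  qed
  then have "(\<Prod>e\<in>E. on_edge (\<lambda>i j. exp (f i j)) e) = exp (\<Sum>e\<in>E. on_edge f e)"
    by (simp add: exp_sum)
  then show ?thesis using sum_on_edge[OF E sym zero] by simp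
qed

section \<open>Elimination of a vertex: the star-mesh transformation\<close>

text \<open>
  This is \<open>A_mat\<close> relative to a subset \<open>I\<close> of the vertices, in a form where the diagonal weight
  \<open>W i i\<close> cancels.  The same is true of \<open>energy\<close> below.  The weights that arise from
  eliminating a vertex may have a nonzero diagonal, which thus has no effect.
\<close>

definition laplacian :: "'v set \<Rightarrow> ('v \<Rightarrow> 'v \<Rightarrow> real) \<Rightarrow> ('v \<Rightarrow> real) \<Rightarrow> 'v \<Rightarrow> 'v \<Rightarrow> real" where
  "laplacian I W u i j =
     (if i = j then \<Sum>k\<in>I. W i k * exp (u i + u k) else 0) - W i j * exp (u i + u j)"

definition energy :: "'v set \<Rightarrow> ('v \<Rightarrow> 'v \<Rightarrow> real) \<Rightarrow> ('v \<Rightarrow> real) \<Rightarrow> ('v \<Rightarrow> real) \<Rightarrow> real" where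
  "energy I W u s = 1/2 * (\<Sum>i\<in>I. \<Sum>j\<in>I.
     W i j * (cosh (u i - u j) - 1 + 1/2 * (s i - s j)\<^sup>2 * exp (u i + u j)))"

text \<open>
  The density of the random fields on the graph spanned by \<open>insert \<delta> T\<close> and pinned at \<open>\<delta>\<close>,
  including the factors \<open>exp (- u i) / (2 * pi)\<close>.
\<close>

definition field_density :: "'v \<Rightarrow> 'v set \<Rightarrow> ('v \<Rightarrow> 'v \<Rightarrow> real) \<Rightarrow> ('v \<Rightarrow> real) \<Rightarrow> ('v \<Rightarrow> real) \<Rightarrow> real"
  where "field_density \<delta> T W u s =
     det_on T (laplacian (insert \<delta> T) W u) * exp (- energy (insert \<delta> T) W u s) *
     (\<Prod>i\<in>T. 1 / (2 * pi) * exp (- u i))"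

text \<open>
  The star-mesh transformation of electrical networks.  When \<open>v\<close> is removed, each pair of its
  neighbours receives the additional conductance \<open>W v i * W v j / y\<close>.  In an electrical network
  \<open>y\<close> would be the total conductance at \<open>v\<close>; here it is the pivot \<open>2 * beta W u v\<close>.
\<close>

definition star_mesh :: "('v \<Rightarrow> 'v \<Rightarrow> real) \<Rightarrow> 'v \<Rightarrow> real \<Rightarrow> 'v \<Rightarrow> 'v \<Rightarrow> real" where
  "star_mesh W v y i j = W i j + W v i * W v j / y"

lemma laplacian_diagonal:
  fixes u :: "'v \<Rightarrow> real" and I :: "'v set"
  assumes I: "finite I" "v \<notin> I"
    and y: "y = (\<Sum>k\<in>I. W v k * exp (u k)) * exp (- u v)"
  shows "laplacian (insert v I) W u v v = y * (exp (u v))\<^sup>2"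
proof -
  have "laplacian (insert v I) W u v v = (\<Sum>k\<in>I. W v k * exp (u v + u k))"
    using I by (simp add: laplacian_def)
  also have "\<dots> = exp (u v) * (\<Sum>k\<in>I. W v k * exp (u k))"
    unfolding exp_add sum_distrib_left by (simp only: mult_ac)
  also have "\<dots> = y * (exp (u v))\<^sup>2"
    unfolding y by (simp add: exp_minus power2_eq_square)
  finally show ?thesis .
qed

text \<open>
  A Schur complement of a weighted graph Laplacian is again a weighted graph Laplacian.  In
  conductances \<open>W i j * exp (u i + u j)\<close> the total conductance at \<open>v\<close> is \<open>y * (exp (u v))\<^sup>2\<close>,
  so the factors \<open>exp (u v)\<close> cancel and the new conductances have the same form.
\<close>

lemma laplacian_schur:
  fixes u :: "'v \<Rightarrow> real" and I :: "'v set"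
  assumes I: "finite I" "v \<notin> I" and ij: "i \<in> I" "j \<in> I" and sym: "\<And>i j. W i j = W j i"
    and y: "y = (\<Sum>k\<in>I. W v k * exp (u k)) * exp (- u v)" "y \<noteq> 0"
  defines "L \<equiv> laplacian (insert v I) W u"
  shows "L i j - L i v * L v j / L v v = laplacian I (star_mesh W v y) u i j"
proof -
  have c: "(\<Sum>k\<in>I. W v k * exp (u k)) = y * exp (u v)"
    unfolding y(1) by (simp add: exp_minus)
  have vv: "L v v = y * (exp (u v))\<^sup>2"
    unfolding L_def by (rule laplacian_diagonal) (use I y in auto)
  have ne: "i \<noteq> v" "j \<noteq> v" using ij I by auto
  have entries: "L i v = - (W v i * exp (u i + u v))" "L v j = - (W v j * exp (u v + u j))"
    using ne sym[of i v] by (simp_all add: L_def laplacian_def)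
  have 1: "L i v * L v j / L v v = W v i * W v j / y * exp (u i + u j)"
    using y(2) unfolding vv entries by (simp add: exp_add power2_eq_square)
  have 2: "(\<Sum>k\<in>I. W v i * W v k / y * exp (u i + u k)) = W v i * exp (u i + u v)"
  proof -
    have "(\<Sum>k\<in>I. W v i * W v k / y * exp (u i + u k)) =
        W v i * exp (u i) / y * (\<Sum>k\<in>I. W v k * exp (u k))"
      by (simp add: sum_distrib_left exp_add mult_ac)
    also have "\<dots> = W v i * exp (u i + u v)" unfolding c using y(2) by (simp add: exp_add)
    finally show ?thesis .
  qed
  have 3: "L i j = (if i = j then (\<Sum>k\<in>I. W i k * exp (u i + u k)) + W v i * exp (u i + u v) else 0)
      - W i j * exp (u i + u j)"
    using I ne sym[of i v] sym[of j v] by (simp add: L_def laplacian_def)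
  have 4: "laplacian I (star_mesh W v y) u i j =
      (if i = j then (\<Sum>k\<in>I. W i k * exp (u i + u k)) + W v i * exp (u i + u v) else 0)
      - (W i j * exp (u i + u j) + W v i * W v j / y * exp (u i + u j))"
    unfolding laplacian_def star_mesh_def distrib_right sum.distrib 2 ..
  show "L i j - L i v * L v j / L v v = laplacian I (star_mesh W v y) u i j"
    unfolding 1 3 4 by (simp only: diff_diff_eq)
qed

lemma det_laplacian_eliminate:
  fixes u :: "'v::finite \<Rightarrow> real"
  assumes I: "v \<notin> I" and T: "T \<subseteq> I" and sym: "\<And>i j. W i j = W j i"
    and y: "y = (\<Sum>k\<in>I. W v k * exp (u k)) * exp (- u v)" "y \<noteq> 0"
  shows "det_on (insert v T) (laplacian (insert v I) W u) =
    y * (exp (u v))\<^sup>2 * det_on T (laplacian I (star_mesh W v y) u)"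
proof -
  let ?L = "laplacian (insert v I) W u"
  have vv: "?L v v = y * (exp (u v))\<^sup>2"
    by (rule laplacian_diagonal) (use I y in auto)
  have "det_on (insert v T) ?L = ?L v v * det_on T (\<lambda>i j. ?L i j - ?L i v * ?L v j / ?L v v)"
    using I T y(2) by (intro det_on_schur_complement) (auto simp: vv)
  also have "det_on T (\<lambda>i j. ?L i j - ?L i v * ?L v j / ?L v v) =
      det_on T (laplacian I (star_mesh W v y) u)"
    using I T y sym by (intro det_on_cong laplacian_schur) auto
  finally show ?thesis by (simp only: vv)
qed

text \<open>
  Completing the square in \<open>t\<close>: the minimum is at the mean of the \<open>s j\<close> weighted by \<open>c j\<close>, and
  the minimal value is the weighted sum of squared deviations from the mean, written as a sum over
  pairs.
\<close>

lemma sum_squares_star_mesh: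
  fixes c s :: "'v \<Rightarrow> real" and I :: "'v set"
  defines "C \<equiv> \<Sum>j\<in>I. c j"
  assumes C: "C \<noteq> 0"
  shows "(\<Sum>j\<in>I. c j * (t - s j)\<^sup>2) =
    C * (t - (\<Sum>j\<in>I. c j * s j) / C)\<^sup>2 + 1/2 * (\<Sum>j\<in>I. \<Sum>k\<in>I. c j * c k / C * (s j - s k)\<^sup>2)"
proof -
  define P where "P = (\<Sum>j\<in>I. c j * s j)"
  define Q where "Q = (\<Sum>j\<in>I. c j * (s j)\<^sup>2)"
  have "(\<Sum>j\<in>I. c j * (t - s j)\<^sup>2) = (\<Sum>j\<in>I. t\<^sup>2 * c j - 2 * t * (c j * s j) + c j * (s j)\<^sup>2)"
    by (intro sum.cong) (auto simp: power2_eq_square algebra_simps)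
  also have "\<dots> = t\<^sup>2 * C - 2 * t * P + Q"
    by (simp only: C_def P_def Q_def sum_distrib_left sum.distrib sum_subtractf)
  finally have 1: "(\<Sum>j\<in>I. c j * (t - s j)\<^sup>2) = t\<^sup>2 * C - 2 * t * P + Q" .
  have "(\<Sum>j\<in>I. \<Sum>k\<in>I. c j * c k / C * (s j - s k)\<^sup>2) =
    (\<Sum>j\<in>I. \<Sum>k\<in>I. 1 / C * ((c j * (s j)\<^sup>2) * c k) - 2 / C * ((c j * s j) * (c k * s k)) + 1 / C * (c j * (c k * (s k)\<^sup>2)))"
    by (intro sum.cong) (auto simp: power2_eq_square algebra_simps)
  also have "\<dots> = 1 / C * (Q * C) - 2 / C * (P * P) + 1 / C * (C * Q)"
    unfolding C_def P_def Q_def sum_product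
    by (simp only: sum_distrib_left sum.distrib sum_subtractf)
  finally have 2: "(\<Sum>j\<in>I. \<Sum>k\<in>I. c j * c k / C * (s j - s k)\<^sup>2) = 2 * Q - 2 * P\<^sup>2 / C"
    using C by (simp add: power2_eq_square)
  show ?thesis unfolding 1 2 P_def[symmetric] using C
    by (simp add: power2_eq_square field_simps)
qed

text \<open>
  The analogue of the preceding lemma for the hyperbolic part: solving the definition of \<open>y\<close> for
  \<open>exp x\<close> removes \<open>x\<close>, and the sum over the star at \<open>v\<close> becomes a sum over pairs of its neighbours.
\<close>

lemma sum_cosh_star_mesh:
  fixes w u :: "'v \<Rightarrow> real"
  assumes y: "y = (\<Sum>k\<in>I. w k * exp (u k)) * exp (- x)" "y \<noteq> 0"
  shows "(\<Sum>j\<in>I. w j * cosh (x - u j)) =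
    1/2 * y + 1/2 * (\<Sum>j\<in>I. \<Sum>k\<in>I. w j * w k / y * cosh (u j - u k))"
proof -
  define c where "c = (\<Sum>k\<in>I. w k * exp (u k))"
  define d where "d = (\<Sum>k\<in>I. w k * exp (- u k))"
  have "(\<Sum>j\<in>I. w j * cosh (x - u j)) =
      (\<Sum>j\<in>I. 1/2 * exp x * (w j * exp (- u j)) + 1/2 * exp (- x) * (w j * exp (u j)))"
    by (intro sum.cong) (auto simp: cosh_def exp_diff exp_minus field_simps)
  also have "\<dots> = 1/2 * exp x * d + 1/2 * exp (- x) * c"
    by (simp only: c_def d_def sum_distrib_left sum.distrib)
  finally have 1: "(\<Sum>j\<in>I. w j * cosh (x - u j)) = 1/2 * exp x * d + 1/2 * exp (- x) * c" .
  have "(\<Sum>j\<in>I. \<Sum>k\<in>I. w j * w k / y * cosh (u j - u k)) =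
     (\<Sum>j\<in>I. \<Sum>k\<in>I. 1 / (2 * y) * ((w j * exp (u j)) * (w k * exp (- u k)))
       + 1 / (2 * y) * ((w j * exp (- u j)) * (w k * exp (u k))))"
    using y(2) by (intro sum.cong) (auto simp: cosh_def exp_diff exp_minus field_simps)
  also have "\<dots> = 1 / (2 * y) * (c * d) + 1 / (2 * y) * (d * c)"
    unfolding c_def d_def sum_product by (simp only: sum_distrib_left sum.distrib)
  finally have 2: "(\<Sum>j\<in>I. \<Sum>k\<in>I. w j * w k / y * cosh (u j - u k)) = c * d / y"
    using y(2) by simp
  have c: "c = y * exp x" using y(1) by (simp add: c_def exp_minus)
  show ?thesis unfolding 1 2 c using y(2) by (simp add: exp_minus)
qed

text \<open>
  Both parts of the energy produce the same additional weights \<open>W v i * W v j / y\<close>, namely those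
  that appear in the Schur complement of the Laplacian.  This coincidence makes the density
  reproduce itself when a vertex is eliminated.
\<close>

lemma energy_eliminate:
  fixes u s :: "'v \<Rightarrow> real" and I :: "'v set"
  assumes I: "finite I" "v \<notin> I" and sym: "\<And>i j. W i j = W j i"
    and y: "y = (\<Sum>k\<in>I. W v k * exp (u k)) * exp (- u v)" "y \<noteq> 0"
  defines "m \<equiv> (\<Sum>j\<in>I. W v j * exp (u v + u j) * s j) / (y * (exp (u v))\<^sup>2)"
    and "S \<equiv> \<Sum>j\<in>I. W v j"
  shows "energy (insert v I) W u s =
    energy I (star_mesh W v y) u s + 1/2 * y + 1/2 * S\<^sup>2 / y - S
      + 1/2 * (y * (exp (u v))\<^sup>2) * (s v - m)\<^sup>2"
proof -
  define F where "F i j = cosh (u i - u j) - 1 + 1/2 * (s i - s j)\<^sup>2 * exp (u i + u j)" for i j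
  have F0: "F i i = 0" for i by (simp add: F_def)
  have Fs: "F i j = F j i" for i j
    using cosh_minus[of "u i - u j"] by (simp add: F_def power2_commute add.commute)
  have "energy (insert v I) W u s = 1/2 * (\<Sum>i\<in>insert v I. \<Sum>j\<in>insert v I. W i j * F i j)"
    by (simp add: energy_def F_def)
  also have "\<dots> = 1/2 * ((\<Sum>j\<in>I. W v j * F v j) + (\<Sum>i\<in>I. W i v * F i v) + (\<Sum>i\<in>I. \<Sum>j\<in>I. W i j * F i j))"
    using I by (simp add: F0 sum.distrib)
  also have "(\<Sum>i\<in>I. W i v * F i v) = (\<Sum>j\<in>I. W v j * F v j)"
    using sym Fs by (metis (mono_tags, lifting) sum.cong)
  finally have 1: "energy (insert v I) W u s =
      (\<Sum>j\<in>I. W v j * F v j) + 1/2 * (\<Sum>i\<in>I. \<Sum>j\<in>I. W i j * F i j)" by simp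
  have "(\<Sum>j\<in>I. W v j * F v j) = (\<Sum>j\<in>I. W v j * cosh (u v - u j)) - S
      + 1/2 * (\<Sum>j\<in>I. W v j * exp (u v + u j) * (s v - s j)\<^sup>2)"
    unfolding S_def sum_distrib_left sum_subtractf[symmetric] sum.distrib[symmetric] F_def
    by (intro sum.cong) (auto simp: algebra_simps)
  also have "(\<Sum>j\<in>I. W v j * cosh (u v - u j)) =
      1/2 * y + 1/2 * (\<Sum>j\<in>I. \<Sum>k\<in>I. W v j * W v k / y * cosh (u j - u k))"
    by (rule sum_cosh_star_mesh) (use y in auto)
  also have "(\<Sum>j\<in>I. W v j * exp (u v + u j) * (s v - s j)\<^sup>2) = y * (exp (u v))\<^sup>2 * (s v - m)\<^sup>2
      + 1/2 * (\<Sum>j\<in>I. \<Sum>k\<in>I. W v j * W v k / y * exp (u j + u k) * (s j - s k)\<^sup>2)"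
  proof -
    have C: "(\<Sum>j\<in>I. W v j * exp (u v + u j)) = y * (exp (u v))\<^sup>2"
      unfolding y(1) by (simp add: exp_add exp_minus power2_eq_square sum_distrib_left mult_ac)
    have "(\<Sum>j\<in>I. \<Sum>k\<in>I. W v j * exp (u v + u j) * (W v k * exp (u v + u k)) / (y * (exp (u v))\<^sup>2) * (s j - s k)\<^sup>2)
       = (\<Sum>j\<in>I. \<Sum>k\<in>I. W v j * W v k / y * exp (u j + u k) * (s j - s k)\<^sup>2)"
      by (intro sum.cong) (auto simp: exp_add power2_eq_square)
    then show ?thesis
      using sum_squares_star_mesh[of "\<lambda>j. W v j * exp (u v + u j)" I "s v" s] y(2)
      unfolding C m_def by simp
  qed
  finally have 2: "(\<Sum>j\<in>I. W v j * F v j) = 1/2 * y + 1/2 * (\<Sum>j\<in>I. \<Sum>k\<in>I. W v j * W v k / y * cosh (u j - u k))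
    - S + 1/2 * (y * (exp (u v))\<^sup>2 * (s v - m)\<^sup>2
      + 1/2 * (\<Sum>j\<in>I. \<Sum>k\<in>I. W v j * W v k / y * exp (u j + u k) * (s j - s k)\<^sup>2))" .
  have "S\<^sup>2 / y = (\<Sum>j\<in>I. \<Sum>k\<in>I. W v j * W v k / y)"
    by (simp add: S_def power2_eq_square sum_product sum_divide_distrib)
  moreover have "star_mesh W v y i j * F i j + W v i * W v j / y = W i j * F i j
      + W v i * W v j / y * cosh (u i - u j)
      + 1/2 * (W v i * W v j / y * exp (u i + u j) * (s i - s j)\<^sup>2)" for i j
  proof -
    have "(w + r) * (h - 1 + 1/2 * q * e) + r =
        w * (h - 1 + 1/2 * q * e) + r * h + 1/2 * (r * e * q)" for w r h q e :: real
      by (simp add: algebra_simps)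
    then show ?thesis unfolding star_mesh_def F_def .
  qed
  then have "(\<Sum>i\<in>I. \<Sum>j\<in>I. star_mesh W v y i j * F i j + W v i * W v j / y) =
      (\<Sum>i\<in>I. \<Sum>j\<in>I. W i j * F i j + W v i * W v j / y * cosh (u i - u j)
      + 1/2 * (W v i * W v j / y * exp (u i + u j) * (s i - s j)\<^sup>2))" by simp
  ultimately have 3: "(\<Sum>i\<in>I. \<Sum>j\<in>I. star_mesh W v y i j * F i j) + S\<^sup>2 / y =
      (\<Sum>i\<in>I. \<Sum>j\<in>I. W i j * F i j)
      + (\<Sum>j\<in>I. \<Sum>k\<in>I. W v j * W v k / y * cosh (u j - u k))
      + 1/2 * (\<Sum>j\<in>I. \<Sum>k\<in>I. W v j * W v k / y * exp (u j + u k) * (s j - s k)\<^sup>2)"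
    by (simp only: sum.distrib sum_distrib_left)
  have 4: "energy I (star_mesh W v y) u s = 1/2 * (\<Sum>i\<in>I. \<Sum>j\<in>I. star_mesh W v y i j * F i j)"
    by (simp only: energy_def F_def)
  have half: "1/2 * S\<^sup>2 / y = 1/2 * (S\<^sup>2 / y)" "1/2 * (y * (exp (u v))\<^sup>2) * (s v - m)\<^sup>2
      = 1/2 * (y * (exp (u v))\<^sup>2 * (s v - m)\<^sup>2)" by simp_all
  have lin: "1/2 * y' + 1/2 * a2 - S' + 1/2 * (g + 1/2 * a3) + 1/2 * a1 =
      1/2 * a + 1/2 * y' + 1/2 * q - S' + 1/2 * g"
    if "a + q = a1 + a2 + 1/2 * a3" for a a1 a2 a3 q g y' S' :: real using that by (simp add: field_simps)
  show ?thesis unfolding 1 2 4 half 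
    using 3 by (rule lin)
qed

section \<open>One-dimensional integrals\<close>

lemma nn_integral_gaussian:
  fixes C m :: real
  assumes "C > 0"
  shows "(\<integral>\<^sup>+t. ennreal (exp (- (1/2 * C * (t - m)\<^sup>2))) \<partial>lborel) = ennreal (sqrt (2 * pi / C))"
proof -
  define \<sigma> where "\<sigma> = 1 / sqrt C"
  have \<sigma>: "\<sigma> > 0" "\<sigma>\<^sup>2 = 1 / C" using assms by (auto simp: \<sigma>_def power_divide)
  interpret prob_space "density lborel (normal_density m \<sigma>)"
    by (rule prob_space_normal_density[OF \<sigma>(1)])
  have "exp (- (1/2 * C * (t - m)\<^sup>2)) = sqrt (2 * pi / C) * normal_density m \<sigma> t" for t
    using assms unfolding normal_density_def \<sigma> by (simp add: field_simps)
  then have "(\<integral>\<^sup>+t. ennreal (exp (- (1/2 * C * (t - m)\<^sup>2))) \<partial>lborel) =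
      ennreal (sqrt (2 * pi / C)) * (\<integral>\<^sup>+t. ennreal (normal_density m \<sigma> t) \<partial>lborel)"
    using assms by (simp add: ennreal_mult' nn_integral_cmult)
  also have "(\<integral>\<^sup>+t. ennreal (normal_density m \<sigma> t) \<partial>lborel) = 1"
    using emeasure_space_1 by (simp add: emeasure_density)
  finally show ?thesis by simp
qed

text \<open>
  The substitution \<open>p = 2 * sqrt S * sinh q\<close> turns this into the integral of the standard normal
  density.
\<close>

lemma nn_integral_gaussian_sinh:
  fixes S :: real
  assumes S: "S > 0"
  shows "(\<integral>\<^sup>+q. ennreal (2 * sqrt S * cosh q / sqrt (2 * pi) * exp (- 2 * S * (sinh q)\<^sup>2)) \<partial>lborel) = 1"
proof -
  let ?g = "\<lambda>q::real. 2 * sqrt S * sinh q"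
  let ?h = "\<lambda>q. \<bar>2 * sqrt S * cosh q\<bar> * std_normal_density (?g q)"
  have h: "?h q = 2 * sqrt S * cosh q / sqrt (2 * pi) * exp (- 2 * S * (sinh q)\<^sup>2)" for q
    using S by (simp add: std_normal_density_def abs_mult power_mult_distrib)
  have "x \<in> range ?g" for x
    using S by (intro image_eqI[of _ _ "arsinh (x / (2 * sqrt S))"]) (auto simp: sinh_arsinh_real)
  then have ran: "range ?g = UNIV" by blast
  have I: "integrable lborel std_normal_density" "integral\<^sup>L lborel std_normal_density = 1"
    by (simp_all add: integral_normal_density integrable_normal_density)
  have "std_normal_density absolutely_integrable_on UNIV"
    using I(1) by (simp add: set_integrable_def integrable_completion)
  moreover have "integral UNIV std_normal_density = 1"
    using integral_lborel[OF I(1)] I(2) by simp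
  ultimately have "?h absolutely_integrable_on UNIV \<and> integral UNIV ?h = 1"
    using S by (subst has_absolute_integral_change_of_variables_1')
      (auto simp: inj_on_def ran intro!: derivative_eq_intros)
  then have "(?h has_integral 1) UNIV"
    using set_lebesgue_integral_eq_integral(1) by (metis has_integral_iff)
  moreover have "?h \<in> borel_measurable borel" unfolding h
    by (intro borel_measurable_continuous_onI continuous_intros) auto
  ultimately have "(\<integral>\<^sup>+q. ennreal (?h q) \<partial>lborel) = ennreal 1"
    by (intro nn_integral_has_integral_lborel) auto
  then show ?thesis unfolding h by simp
qed

lemma nn_integral_reflect:
  fixes f :: "real \<Rightarrow> ennreal"
  assumes "f \<in> borel_measurable borel"
  shows "(\<integral>\<^sup>+x. f x \<partial>lborel) = (\<integral>\<^sup>+x. f (t - x) \<partial>lborel)"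
  using nn_integral_real_affine[OF assms, of "-1" t] by simp

text \<open>
  In the variable \<open>y\<close>, \<open>elim_factor S y / y\<close> is the density of a reciprocal inverse Gaussian
  distribution: this is the law of \<open>2 * beta W u v\<close> if the weights at \<open>v\<close> sum to \<open>S\<close>.
\<close>

definition elim_factor :: "real \<Rightarrow> real \<Rightarrow> real" where
  "elim_factor S y = sqrt y / sqrt (2 * pi) * exp (- (1/2 * y + 1/2 * S\<^sup>2 / y - S))"

text \<open>
  With \<open>z = ln S + 2 * q\<close> the exponent becomes \<open>- 2 * S * (sinh q)\<^sup>2\<close>, which is even in \<open>q\<close>.  Hence the
  remaining factor \<open>exp q\<close> may be replaced by its even part \<open>cosh q\<close>.
\<close>

lemma nn_integral_elim_factor:
  fixes S :: real
  assumes S: "S > 0"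
  shows "(\<integral>\<^sup>+z. ennreal (elim_factor S (exp z)) \<partial>lborel) = 1"
proof -
  define E where "E q = 2 * sqrt S / sqrt (2 * pi) * exp (- 2 * S * (sinh q)\<^sup>2)" for q
  have E0: "E q \<ge> 0" for q using S by (simp add: E_def)
  have [measurable]: "E \<in> borel_measurable borel"
    unfolding E_def sinh_field_def by measurable
  have fac: "2 * elim_factor S (exp (ln S + 2 * q)) = exp q * E q" for q
  proof -
    have 1: "exp (ln S + 2 * q) = S * (exp q)\<^sup>2" using S by (simp add: exp_add exp_double)
    have 2: "2 * S * (sinh q)\<^sup>2 = 1/2 * (S * (exp q)\<^sup>2) + 1/2 * S\<^sup>2 / (S * (exp q)\<^sup>2) - S"
      using S by (simp add: sinh_def exp_minus power2_eq_square field_simps)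
    have 3: "- (1/2 * (S * (exp q)\<^sup>2) + 1/2 * S\<^sup>2 / (S * (exp q)\<^sup>2) - S) = - 2 * S * (sinh q)\<^sup>2"
      using 2 by linarith
    have 4: "sqrt (S * (exp q)\<^sup>2) = sqrt S * exp q" by (simp add: real_sqrt_mult)
    show ?thesis unfolding elim_factor_def E_def 1 3 4 by simp
  qed
  have [measurable]: "elim_factor S \<in> borel_measurable borel"
    unfolding elim_factor_def by measurable
  have "(\<integral>\<^sup>+z. ennreal (elim_factor S (exp z)) \<partial>lborel) =
      ennreal \<bar>2\<bar> * (\<integral>\<^sup>+q. ennreal (elim_factor S (exp (ln S + 2 * q))) \<partial>lborel)"
    
  proof (rule nn_integral_real_affine)
    show "(\<lambda>z. ennreal (elim_factor S (exp z))) \<in> borel_measurable borel" by measurable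
  qed simp
  also have "\<dots> = (\<integral>\<^sup>+q. ennreal \<bar>2\<bar> * ennreal (elim_factor S (exp (ln S + 2 * q))) \<partial>lborel)"
    by (rule nn_integral_cmult[symmetric]) (unfold elim_factor_def, measurable)
  also have "\<dots> = (\<integral>\<^sup>+q. ennreal (exp q * E q) \<partial>lborel)"
    by (intro nn_integral_cong, subst ennreal_mult'[symmetric]) (simp_all add: fac)
  finally have 1: "(\<integral>\<^sup>+z. ennreal (elim_factor S (exp z)) \<partial>lborel) = (\<integral>\<^sup>+q. ennreal (exp q * E q) \<partial>lborel)" .
  have even: "E (- q) = E q" for q by (simp add: E_def)
  have 2: "(\<integral>\<^sup>+q. ennreal (exp q * E q) \<partial>lborel) = (\<integral>\<^sup>+q. ennreal (exp (- q) * E q) \<partial>lborel)"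
    by (subst nn_integral_reflect[where t=0]) (measurable, simp add: even)
  have cosh: "exp q * E q + exp (- q) * E q =
      2 * (2 * sqrt S * cosh q / sqrt (2 * pi) * exp (- 2 * S * (sinh q)\<^sup>2))" for q
    unfolding E_def cosh_field_def by (simp add: distrib_left distrib_right mult_ac add_divide_distrib)
  have "2 * (\<integral>\<^sup>+q. ennreal (exp q * E q) \<partial>lborel) =
      (\<integral>\<^sup>+q. ennreal (exp q * E q) \<partial>lborel) + (\<integral>\<^sup>+q. ennreal (exp (- q) * E q) \<partial>lborel)"
    by (simp only: mult_2 2)
  also have "\<dots> = (\<integral>\<^sup>+q. ennreal (exp q * E q) + ennreal (exp (- q) * E q) \<partial>lborel)"
    by (rule nn_integral_add[symmetric]) measurable
  also have "\<dots> = (\<integral>\<^sup>+q. 2 * ennreal (2 * sqrt S * cosh q / sqrt (2 * pi) * exp (- 2 * S * (sinh q)\<^sup>2)) \<partial>lborel)"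
    by (intro nn_integral_cong, subst ennreal_plus[symmetric])
      (simp_all only: E0 mult_nonneg_nonneg exp_ge_zero cosh ennreal_mult' ennreal_numeral zero_le_numeral)
  also have "\<dots> = 2 * 1"
    unfolding nn_integral_gaussian_sinh[OF S, symmetric] sinh_field_def cosh_field_def
    by (rule nn_integral_cmult) measurable
  finally have "2 * (\<integral>\<^sup>+q. ennreal (exp q * E q) \<partial>lborel) = 2 * 1" .
  then show ?thesis unfolding 1 ennreal_mult_cancel_left by simp
qed

section \<open>Integration over the fields at one vertex\<close>

abbreviation pinned_family :: "'v \<Rightarrow> 'v \<Rightarrow> real measure" where
  "pinned_family \<delta> \<equiv> \<lambda>i. if i = \<delta> then return borel 0 else lborel"

lemma product_sigma_finite_pinned: "product_sigma_finite (pinned_family (\<delta> :: 'v))"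
proof (rule product_sigma_finite.intro)
  fix i :: 'v
  interpret r: prob_space "return borel (0::real)" by (rule prob_space_return) simp
  show "sigma_finite_measure (pinned_family \<delta> i)"
    using r.sigma_finite_measure_axioms lborel.sigma_finite_measure_axioms[where 'a=real] by simp
qed

lemma borel_measurable_component_pinned:
  "i \<in> I \<Longrightarrow> (\<lambda>u. u i) \<in> borel_measurable (PiM I (pinned_family \<delta>))"
  using measurable_component_singleton[of i I "pinned_family \<delta>"]
  by (cases "i = \<delta>") (simp_all cong: measurable_cong_sets)

lemma laplacian_cong:
  assumes "\<And>i. i \<in> I \<Longrightarrow> u i = u' i" "i \<in> I" "j \<in> I"
  shows "laplacian I W u i j = laplacian I W u' i j"
  using assms by (simp add: laplacian_def)

lemma field_density_cong:
  assumes "\<And>i. i \<in> insert \<delta> T \<Longrightarrow> u i = u' i" "\<And>i. i \<in> insert \<delta> T \<Longrightarrow> s i = s' i"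
  shows "field_density \<delta> T W u s = field_density \<delta> T W u' s'"
proof -
  have "det_on T (laplacian (insert \<delta> T) W u) = det_on T (laplacian (insert \<delta> T) W u')"
    using assms by (intro det_on_cong laplacian_cong) auto
  moreover have "energy (insert \<delta> T) W u s = energy (insert \<delta> T) W u' s'"
    unfolding energy_def using assms by (intro arg_cong2[where f="(*)"] sum.cong refl) auto
  moreover have "(\<Prod>i\<in>T. 1 / (2 * pi) * exp (- u i)) = (\<Prod>i\<in>T. 1 / (2 * pi) * exp (- u' i))"
    using assms by (intro prod.cong) auto
  ultimately show ?thesis by (simp add: field_density_def)
qed

lemma borel_measurable_field_density:
  fixes T :: "'v::finite set"
  assumes U: "\<And>i. i \<in> insert \<delta> T \<Longrightarrow> (\<lambda>x. U x i) \<in> borel_measurable X"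
    and S: "\<And>i. i \<in> insert \<delta> T \<Longrightarrow> (\<lambda>x. S x i) \<in> borel_measurable X"
    and W: "\<And>i j. i \<in> insert \<delta> T \<Longrightarrow> j \<in> insert \<delta> T \<Longrightarrow> (\<lambda>x. W x i j) \<in> borel_measurable X"
  shows "(\<lambda>x. field_density \<delta> T (W x) (U x) (S x)) \<in> borel_measurable X"
proof -
  have e: "(\<lambda>x. exp (U x i + U x j)) \<in> borel_measurable X"
    if "i \<in> insert \<delta> T" "j \<in> insert \<delta> T" for i j
    by (rule measurable_compose[OF borel_measurable_add[OF U U] borel_measurable_exp])
      (use that in auto)
  have L: "(\<lambda>x. laplacian (insert \<delta> T) (W x) (U x) i j) \<in> borel_measurable X"
    if "i \<in> insert \<delta> T" "j \<in> insert \<delta> T" for i j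
  proof (cases "i = j")
    case True
    with that show ?thesis unfolding laplacian_def
      by (simp only: simp_thms if_True, intro borel_measurable_diff borel_measurable_sum borel_measurable_times W e)
  next
    case False
    with that show ?thesis unfolding laplacian_def
      by (simp only: simp_thms if_False, intro borel_measurable_diff borel_measurable_const borel_measurable_times W e)
  qed
  have "(\<lambda>x. det_on T (laplacian (insert \<delta> T) (W x) (U x))) \<in> borel_measurable X"
    unfolding det_on_def
    by (intro borel_measurable_sum borel_measurable_times borel_measurable_const borel_measurable_prod L)
      (auto simp: permutes_in_image)
  moreover have "(cosh :: real \<Rightarrow> real) \<in> borel_measurable borel"
    unfolding cosh_field_def by measurable
  then have h: "(\<lambda>x. cosh (U x i - U x j)) \<in> borel_measurable X"
    if "i \<in> insert \<delta> T" "j \<in> insert \<delta> T" for i j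
    using that by (intro measurable_compose[OF borel_measurable_diff[OF U U]])
  have "(\<lambda>x. energy (insert \<delta> T) (W x) (U x) (S x)) \<in> borel_measurable X"
    unfolding energy_def
    by (intro borel_measurable_sum borel_measurable_times borel_measurable_const borel_measurable_diff
        borel_measurable_add borel_measurable_power S W h e)
  moreover have "(\<lambda>x. \<Prod>i\<in>T. 1 / (2 * pi) * exp (- U x i)) \<in> borel_measurable X"
    by (intro borel_measurable_prod borel_measurable_times borel_measurable_const
        measurable_compose[OF borel_measurable_uminus[OF U] borel_measurable_exp]) auto
  ultimately show ?thesis
    unfolding field_density_def
    by (intro borel_measurable_times measurable_compose[OF borel_measurable_uminus borel_measurable_exp])
qed

text \<open>
  Determinant, energy and Jacobian factors combined.  The powers of \<open>exp (u v)\<close> leave the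
  factor \<open>exp (u v)\<close>, which the Gaussian integral over \<open>s v\<close> cancels.
\<close>

lemma field_density_eliminate:
  fixes T :: "'v::finite set" and u s :: "'v \<Rightarrow> real"
  assumes T: "v \<notin> insert \<delta> T" and sym: "\<And>i j. W i j = W j i"
    and y: "y = (\<Sum>k\<in>insert \<delta> T. W v k * exp (u k)) * exp (- u v)" "y \<noteq> 0"
  defines "m \<equiv> (\<Sum>j\<in>insert \<delta> T. W v j * exp (u v + u j) * s j) / (y * (exp (u v))\<^sup>2)"
    and "S \<equiv> \<Sum>j\<in>insert \<delta> T. W v j"
  shows "field_density \<delta> (insert v T) W u s =
    y * exp (u v) / (2 * pi) * exp (- (1/2 * y + 1/2 * S\<^sup>2 / y - S)) *
    exp (- (1/2 * (y * (exp (u v))\<^sup>2) * (s v - m)\<^sup>2)) * field_density \<delta> T (star_mesh W v y) u s"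
proof -
  let ?I = "insert \<delta> T"
  have eq: "insert \<delta> (insert v T) = insert v ?I" by auto
  have d: "det_on (insert v T) (laplacian (insert v ?I) W u) =
      y * (exp (u v))\<^sup>2 * det_on T (laplacian ?I (star_mesh W v y) u)"
    by (rule det_laplacian_eliminate) (use T sym y in auto)
  have e: "energy (insert v ?I) W u s = energy ?I (star_mesh W v y) u s + 1/2 * y + 1/2 * S\<^sup>2 / y - S
      + 1/2 * (y * (exp (u v))\<^sup>2) * (s v - m)\<^sup>2"
    unfolding m_def S_def by (rule energy_eliminate) (use T sym y in auto)
  have p: "(\<Prod>i\<in>insert v T. 1 / (2 * pi) * exp (- u i)) =
      exp (- u v) / (2 * pi) * (\<Prod>i\<in>T. 1 / (2 * pi) * exp (- u i))"
    using T by simp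
  have x: "(exp (u v))\<^sup>2 * exp (- u v) = exp (u v)" by (simp add: exp_minus power2_eq_square)
  have ee: "exp (- energy (insert v ?I) W u s) = exp (- energy ?I (star_mesh W v y) u s) *
      exp (- (1/2 * y + 1/2 * S\<^sup>2 / y - S)) * exp (- (1/2 * (y * (exp (u v))\<^sup>2) * (s v - m)\<^sup>2))"
    unfolding e by (simp add: exp_add[symmetric])
  have "field_density \<delta> (insert v T) W u s =
    y * ((exp (u v))\<^sup>2 * exp (- u v)) / (2 * pi) * exp (- (1/2 * y + 1/2 * S\<^sup>2 / y - S)) *
    exp (- (1/2 * (y * (exp (u v))\<^sup>2) * (s v - m)\<^sup>2)) * field_density \<delta> T (star_mesh W v y) u s"
    unfolding field_density_def eq d ee p by (simp only: mult_ac times_divide_eq_left times_divide_eq_right)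
  then show ?thesis unfolding x .
qed

text \<open>
  Integration over the \<open>s\<close>-coordinate at \<open>v\<close>, while its \<open>u\<close>-coordinate \<open>x\<close> is kept fixed.  The
  result depends on \<open>x\<close> only through \<open>y\<close>.
\<close>

lemma nn_integral_eliminate_s:
  fixes T :: "'v::finite set" and x :: real
  assumes T: "v \<notin> insert \<delta> T" and sym: "\<And>i j. W i j = W j i"
    and c: "0 < (\<Sum>k\<in>insert \<delta> T. W v k * exp (u k))"
  defines "y \<equiv> (\<Sum>k\<in>insert \<delta> T. W v k * exp (u k)) * exp (- x)"
  shows "(\<integral>\<^sup>+t. ennreal (field_density \<delta> (insert v T) W (u(v := x)) (s(v := t))) \<partial>lborel) =
    ennreal (elim_factor (\<Sum>j\<in>insert \<delta> T. W v j) y) * ennreal (field_density \<delta> T (star_mesh W v y) u s)"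
proof -
  let ?I = "insert \<delta> T"
  define S where "S = (\<Sum>j\<in>?I. W v j)"
  define m where "m = (\<Sum>j\<in>?I. W v j * exp (x + u j) * s j) / (y * (exp x)\<^sup>2)"
  define K where "K = y * exp x / (2 * pi) * exp (- (1/2 * y + 1/2 * S\<^sup>2 / y - S))"
  have y: "y > 0" using c by (simp add: y_def)
  have K: "K \<ge> 0" using y by (simp add: K_def)
  have upd: "k \<in> ?I \<Longrightarrow> (f(v := z)) k = f k" for f :: "'v \<Rightarrow> real" and z k using T by auto
  have "field_density \<delta> (insert v T) W (u(v := x)) (s(v := t)) =
      K * exp (- (1/2 * (y * (exp x)\<^sup>2) * (t - m)\<^sup>2)) * field_density \<delta> T (star_mesh W v y) u s" for t
  proof -
    have "field_density \<delta> T (star_mesh W v y) (u(v := x)) (s(v := t)) = field_density \<delta> T (star_mesh W v y) u s"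
      using T by (intro field_density_cong) auto
    moreover have "(\<Sum>k\<in>?I. W v k * exp ((u(v := x)) k)) = (\<Sum>k\<in>?I. W v k * exp (u k))"
      using upd by (intro sum.cong) auto
    moreover have "(\<Sum>j\<in>?I. W v j * exp ((u(v := x)) v + (u(v := x)) j) * (s(v := t)) j) =
        (\<Sum>j\<in>?I. W v j * exp (x + u j) * s j)"
      using upd by (intro sum.cong) auto
    ultimately show ?thesis
      using field_density_eliminate[where u="u(v := x)" and s="s(v := t)", OF T sym, of y] y
      unfolding S_def m_def K_def by (simp only: fun_upd_same y_def less_irrefl)
  qed
  then have "(\<integral>\<^sup>+t. ennreal (field_density \<delta> (insert v T) W (u(v := x)) (s(v := t))) \<partial>lborel) =
      (\<integral>\<^sup>+t. ennreal K * ennreal (exp (- (1/2 * (y * (exp x)\<^sup>2) * (t - m)\<^sup>2)))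
         * ennreal (field_density \<delta> T (star_mesh W v y) u s) \<partial>lborel)"
    using K by (simp add: ennreal_mult')
  also have "\<dots> = ennreal K * (\<integral>\<^sup>+t. ennreal (exp (- (1/2 * (y * (exp x)\<^sup>2) * (t - m)\<^sup>2))) \<partial>lborel)
      * ennreal (field_density \<delta> T (star_mesh W v y) u s)"
    by (simp add: nn_integral_multc nn_integral_cmult)
  also have "(\<integral>\<^sup>+t. ennreal (exp (- (1/2 * (y * (exp x)\<^sup>2) * (t - m)\<^sup>2))) \<partial>lborel) =
      ennreal (sqrt (2 * pi / (y * (exp x)\<^sup>2)))"
    using y by (intro nn_integral_gaussian) simp
  also have "ennreal K * ennreal (sqrt (2 * pi / (y * (exp x)\<^sup>2))) = ennreal (elim_factor S y)"
  proof -
    have "K * sqrt (2 * pi / (y * (exp x)\<^sup>2)) = elim_factor S y"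
      using y real_sqrt_mult_self[of y] real_sqrt_mult_self[of pi] real_sqrt_mult_self[of 2]
      unfolding K_def elim_factor_def
      by (simp add: real_sqrt_mult real_sqrt_divide field_simps)
    then show ?thesis using K by (simp add: ennreal_mult'[symmetric])
  qed
  finally show ?thesis by (simp only: S_def)
qed

section \<open>The total mass of the density\<close>

text \<open>
  The hypothesis \<open>esc\<close> says that \<open>\<delta>\<close> can be reached from everywhere.  It is stated as
  a condition on cuts because in this form it passes directly to the graph without \<open>v\<close>: an edge that
  leaves \<open>R\<close> towards \<open>v\<close> is continued by an edge that leaves \<open>insert v R\<close>, and if the
  latter starts at \<open>v\<close> then the two produce a star-mesh edge.
\<close>

lemma star_mesh_escape:
  assumes v: "v \<notin> insert \<delta> T" and sym: "\<And>i j. W i j = W j i" and nn: "\<And>i j. 0 \<le> W i j" and y: "0 < y"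
    and esc: "\<And>R. R \<subseteq> insert v T \<Longrightarrow> R \<noteq> {} \<Longrightarrow> \<exists>i\<in>R. \<exists>j\<in>insert \<delta> (insert v T) - R. 0 < W i j"
    and R: "R \<subseteq> T" "R \<noteq> {}"
  shows "\<exists>i\<in>R. \<exists>j\<in>insert \<delta> T - R. 0 < star_mesh W v y i j"
proof -
  have ge: "W i j \<le> star_mesh W v y i j" for i j
    using nn y by (simp add: star_mesh_def)
  have via: "0 < star_mesh W v y i j" if "0 < W v i" "0 < W v j" for i j
    using that nn[of i j] y by (simp add: star_mesh_def add_nonneg_pos)
  obtain i j where ij: "i \<in> R" "j \<in> insert \<delta> (insert v T) - R" "0 < W i j"
    using esc[of R] R by blast
  show ?thesis
  proof (cases "j = v")
    case False
    with ij have "j \<in> insert \<delta> T - R" "0 < star_mesh W v y i j"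
      using ge[of i j] by (auto intro: less_le_trans)
    with ij(1) show ?thesis by blast
  next
    case True
    obtain i' j' where ij': "i' \<in> insert v R" "j' \<in> insert \<delta> (insert v T) - insert v R" "0 < W i' j'"
      using esc[of "insert v R"] R by blast
    then have j': "j' \<in> insert \<delta> T - R" by blast
    show ?thesis
    proof (cases "i' = v")
      case True': True
      have "0 < star_mesh W v y i j'"
        using via[of i j'] ij(3) ij'(3) sym[of i v] True True' by simp
      with ij(1) j' show ?thesis by blast
    next
      case False
      then have "i' \<in> R" using ij'(1) by simp
      moreover have "0 < star_mesh W v y i' j'" using ge[of i' j'] ij'(3) by (rule less_le_trans[rotated])
      ultimately show ?thesis using j' by blast
    qed
  qed
qed

text \<open>
  For fixed values of the other coordinates the \<open>u\<close>-coordinate \<open>x\<close> at \<open>v\<close> is replaced by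
  \<open>z = ln (c u) - x\<close>, that is by the logarithm of the pivot \<open>y\<close>.  This is a reflection, so it
  preserves Lebesgue measure.  In the new variable the weights of the remaining graph depend on
  \<open>z\<close> alone, and by Tonelli's theorem the integral over \<open>z\<close> may be done last.
\<close>

lemma nn_integral_eliminate:
  fixes T :: "'v::finite set" and \<delta> v :: 'v
  assumes v: "v \<notin> insert \<delta> T" and sym: "\<And>i j. W i j = W j i" and nn: "\<And>i j. 0 \<le> W i j"
    and pos: "0 < (\<Sum>j\<in>insert \<delta> T. W v j)"
  defines "P \<equiv> PiM (insert \<delta> T) (pinned_family \<delta>)"
    and "P' \<equiv> PiM (insert \<delta> (insert v T)) (pinned_family \<delta>)"
  shows "(\<integral>\<^sup>+u. \<integral>\<^sup>+s. ennreal (field_density \<delta> (insert v T) W u s) \<partial>P' \<partial>P') =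
    (\<integral>\<^sup>+z. ennreal (elim_factor (\<Sum>j\<in>insert \<delta> T. W v j) (exp z)) *
      (\<integral>\<^sup>+u. \<integral>\<^sup>+s. ennreal (field_density \<delta> T (star_mesh W v (exp z)) u s) \<partial>P \<partial>P) \<partial>lborel)"
proof -
  let ?I = "insert \<delta> T"
  define S where "S = (\<Sum>j\<in>?I. W v j)"
  define c where "c u = (\<Sum>k\<in>?I. W v k * exp (u k))" for u :: "'v \<Rightarrow> real"
  let ?k = "\<lambda>z. ennreal (elim_factor S (exp z))"
  let ?f = "\<lambda>z u s. ennreal (field_density \<delta> T (star_mesh W v (exp z)) u s)"
  let ?F = "\<lambda>u s. ennreal (field_density \<delta> (insert v T) W u s)"
  interpret product_sigma_finite "pinned_family \<delta>" by (rule product_sigma_finite_pinned)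
  interpret P: sigma_finite_measure P unfolding P_def by (rule sigma_finite) simp
  interpret P': sigma_finite_measure P' unfolding P'_def by (rule sigma_finite) simp
  interpret lP: pair_sigma_finite lborel P ..
  have P'_eq: "P' = PiM (insert v ?I) (pinned_family \<delta>)" by (simp add: P'_def insert_commute)
  have vd: "v \<noteq> \<delta>" using v by auto
  have [measurable]: "i \<in> ?I \<Longrightarrow> (\<lambda>u. u i) \<in> borel_measurable P" for i
    unfolding P_def by (rule borel_measurable_component_pinned)
  have comp': "i \<in> insert \<delta> (insert v T) \<Longrightarrow> (\<lambda>u. u i) \<in> borel_measurable P'" for i
    unfolding P'_def by (rule borel_measurable_component_pinned)
  have split: "(\<integral>\<^sup>+u. h u \<partial>P') = (\<integral>\<^sup>+u. \<integral>\<^sup>+x. h (u(v := x)) \<partial>lborel \<partial>P)"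
    if "h \<in> borel_measurable P'" for h
    using product_nn_integral_insert[of ?I v h] that v vd by (simp add: P_def P'_eq)
  have meas_f: "(\<lambda>x. ?f (a x) (b x) (d x)) \<in> borel_measurable X"
    if "a \<in> borel_measurable X" "b \<in> measurable X P" "d \<in> measurable X P" for a b d X
  proof -
    have "(\<lambda>x. star_mesh W v (exp (a x)) i j) \<in> borel_measurable X" for i j
      unfolding star_mesh_def using that(1) by measurable
    moreover have "(\<lambda>x. b x i) \<in> borel_measurable X" "(\<lambda>x. d x i) \<in> borel_measurable X" if "i \<in> ?I" for i
      using measurable_compose[OF \<open>b \<in> measurable X P\<close>] measurable_compose[OF \<open>d \<in> measurable X P\<close>]
        borel_measurable_component_pinned[OF that] unfolding P_def by blast+
    ultimately show ?thesis
      by (intro measurable_compose[OF _ measurable_ennreal] borel_measurable_field_density)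
  qed
  have meas_F: "(\<lambda>(u, s). ?F u s) \<in> borel_measurable (P' \<Otimes>\<^sub>M P')"
    unfolding case_prod_beta
    by (intro measurable_compose[OF _ measurable_ennreal] borel_measurable_field_density borel_measurable_const
        measurable_compose[OF measurable_fst comp'] measurable_compose[OF measurable_snd comp'])
  have meas_Fu: "(\<lambda>s. ?F u s) \<in> borel_measurable P'" for u
    by (intro measurable_compose[OF _ measurable_ennreal] borel_measurable_field_density borel_measurable_const comp')
  have meas_k: "?k \<in> borel_measurable borel"
    unfolding elim_factor_def by measurable
  have meas_g: "(\<lambda>(z, u). \<integral>\<^sup>+s. ?f z u s \<partial>P) \<in> borel_measurable (lborel \<Otimes>\<^sub>M P)"
    unfolding case_prod_beta
    by (rule P.borel_measurable_nn_integral, unfold case_prod_beta, rule meas_f) measurable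
  have meas_gz: "(\<lambda>u. \<integral>\<^sup>+s. ?f z u s \<partial>P) \<in> borel_measurable P" for z
    by (rule P.borel_measurable_nn_integral, unfold case_prod_beta, rule meas_f) measurable
  have meas_gu: "(\<lambda>z. \<integral>\<^sup>+s. ?f z u s \<partial>P) \<in> borel_measurable borel" if "u \<in> space P" for u
    by (rule P.borel_measurable_nn_integral, unfold case_prod_beta, rule meas_f)
      (use that in measurable)
  have c: "0 < c u" for u
  proof -
    have "\<exists>j\<in>?I. W v j \<noteq> 0"
    proof (rule ccontr)
      assume "\<not> (\<exists>j\<in>?I. W v j \<noteq> 0)"
      then have "(\<Sum>j\<in>?I. W v j) = 0" by (intro sum.neutral) blast
      with pos show False by simp
    qed
    then obtain j where "j \<in> ?I" "W v j \<noteq> 0" by blast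
    then have "j \<in> ?I" "0 < W v j" using nn[of v j] by auto
    then show ?thesis unfolding c_def using nn by (intro sum_pos2[of _ j]) auto
  qed
  have inner: "(\<integral>\<^sup>+x. \<integral>\<^sup>+s. ?F (u(v := x)) s \<partial>P' \<partial>lborel) = (\<integral>\<^sup>+z. ?k z * (\<integral>\<^sup>+s. ?f z u s \<partial>P) \<partial>lborel)"
    if u: "u \<in> space P" for u
  proof -
    \<comment> \<open>The pivot \<open>y\<close> is \<open>c u * exp (- x)\<close>, the exponential of the new variable.\<close>
    have "(\<integral>\<^sup>+s. ?F (u(v := x)) s \<partial>P') = ?k (ln (c u) - x) * (\<integral>\<^sup>+s. ?f (ln (c u) - x) u s \<partial>P)" for x
    proof -
      have e: "exp (ln (c u) - x) = c u * exp (- x)" using c[of u] by (simp add: exp_diff exp_minus field_simps)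
      have "(\<integral>\<^sup>+s. ?F (u(v := x)) s \<partial>P') = (\<integral>\<^sup>+s. \<integral>\<^sup>+t. ?F (u(v := x)) (s(v := t)) \<partial>lborel \<partial>P)"
        by (rule split[OF meas_Fu])
      also have "\<dots> = (\<integral>\<^sup>+s. ?k (ln (c u) - x) * ?f (ln (c u) - x) u s \<partial>P)"
        unfolding e unfolding c_def S_def
        by (intro nn_integral_cong nn_integral_eliminate_s v sym c[unfolded c_def])
      also have "\<dots> = ?k (ln (c u) - x) * (\<integral>\<^sup>+s. ?f (ln (c u) - x) u s \<partial>P)"
        by (rule nn_integral_cmult) (rule meas_f; use u in measurable)
      finally show ?thesis .
    qed
    then have "(\<integral>\<^sup>+x. \<integral>\<^sup>+s. ?F (u(v := x)) s \<partial>P' \<partial>lborel) =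
        (\<integral>\<^sup>+x. (\<lambda>z. ?k z * (\<integral>\<^sup>+s. ?f z u s \<partial>P)) (ln (c u) - x) \<partial>lborel)" by simp
    also have "\<dots> = (\<integral>\<^sup>+z. ?k z * (\<integral>\<^sup>+s. ?f z u s \<partial>P) \<partial>lborel)"
      by (rule nn_integral_reflect[symmetric]) (intro borel_measurable_times_ennreal meas_k meas_gu u)
    finally show ?thesis .
  qed
  have "(\<integral>\<^sup>+u. \<integral>\<^sup>+s. ?F u s \<partial>P' \<partial>P') = (\<integral>\<^sup>+u. \<integral>\<^sup>+x. \<integral>\<^sup>+s. ?F (u(v := x)) s \<partial>P' \<partial>lborel \<partial>P)"
    by (rule split) (rule P'.borel_measurable_nn_integral[OF meas_F])
  also have "\<dots> = (\<integral>\<^sup>+u. \<integral>\<^sup>+z. ?k z * (\<integral>\<^sup>+s. ?f z u s \<partial>P) \<partial>lborel \<partial>P)"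
    by (intro nn_integral_cong inner)
  also have "\<dots> = (\<integral>\<^sup>+z. \<integral>\<^sup>+u. ?k z * (\<integral>\<^sup>+s. ?f z u s \<partial>P) \<partial>P \<partial>lborel)"
  proof (rule lP.Fubini')
    show "(\<lambda>(z, u). ?k z * (\<integral>\<^sup>+s. ?f z u s \<partial>P)) \<in> borel_measurable (lborel \<Otimes>\<^sub>M P)"
      using meas_g unfolding case_prod_beta
      by (intro borel_measurable_times_ennreal measurable_compose[OF measurable_fst, of ?k] meas_k)
        (use meas_k in simp_all)
  qed
  also have "\<dots> = (\<integral>\<^sup>+z. ?k z * (\<integral>\<^sup>+u. \<integral>\<^sup>+s. ?f z u s \<partial>P \<partial>P) \<partial>lborel)"
    by (intro nn_integral_cong nn_integral_cmult meas_gz)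
  finally show ?thesis by (simp only: S_def)
qed

text \<open>
  The density has total mass 1 for every graph in which \<open>\<delta>\<close> is reachable.  By induction the inner integral in
  \<open>nn_integral_eliminate\<close> is 1 for all values of \<open>z\<close>, and the integral of \<open>elim_factor\<close>
  is 1 as well.
\<close>

theorem nn_integral_field_density:
  fixes T :: "'v::finite set" and \<delta> :: 'v
  assumes "\<delta> \<notin> T" and "\<And>i j. W i j = W j i" and "\<And>i j. 0 \<le> W i j"
    and "\<And>R. R \<subseteq> T \<Longrightarrow> R \<noteq> {} \<Longrightarrow> \<exists>i\<in>R. \<exists>j\<in>insert \<delta> T - R. 0 < W i j"
  shows "(\<integral>\<^sup>+u. \<integral>\<^sup>+s. ennreal (field_density \<delta> T W u s)
      \<partial>PiM (insert \<delta> T) (pinned_family \<delta>) \<partial>PiM (insert \<delta> T) (pinned_family \<delta>)) = 1"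
  using finite[of T] assms
proof (induction T arbitrary: W rule: finite_induct)
  case empty
  interpret prob_space "return borel (0::real)" by (rule prob_space_return) simp
  interpret product_sigma_finite "pinned_family \<delta>" by (rule product_sigma_finite_pinned)
  have "emeasure (PiM {\<delta>} (pinned_family \<delta>)) (space (PiM {\<delta>} (pinned_family \<delta>))) = 1"
    using emeasure_space_1 by (simp add: space_PiM emeasure_PiM)
  then show ?case by (simp add: field_density_def det_on_empty energy_def)
next
  case (insert v T)
  have v: "v \<notin> insert \<delta> T" using insert by auto
  have pos: "0 < (\<Sum>j\<in>insert \<delta> T. W v j)"
  proof -
    obtain j where "j \<in> insert \<delta> T" "0 < W v j"
      using insert.prems(4)[of "{v}"] by auto
    then show ?thesis using insert.prems(3) by (intro sum_pos2[of _ j]) auto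
  qed
  have "(\<integral>\<^sup>+u. \<integral>\<^sup>+s. ennreal (field_density \<delta> T (star_mesh W v (exp z)) u s)
      \<partial>PiM (insert \<delta> T) (pinned_family \<delta>) \<partial>PiM (insert \<delta> T) (pinned_family \<delta>)) = 1" for z
  proof (rule insert.IH)
    show "\<delta> \<notin> T" using insert.prems(1) by simp
    show "star_mesh W v (exp z) i j = star_mesh W v (exp z) j i" for i j
      using insert.prems(2)[of i j] by (simp add: star_mesh_def)
    show "0 \<le> star_mesh W v (exp z) i j" for i j
      using insert.prems(3) by (simp add: star_mesh_def)
    show "\<exists>i\<in>R. \<exists>j\<in>insert \<delta> T - R. 0 < star_mesh W v (exp z) i j" if "R \<subseteq> T" "R \<noteq> {}" for R
      using star_mesh_escape[OF v insert.prems(2) insert.prems(3) _ insert.prems(4) that, of "exp z"] by simp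
  qed
  then show ?case
    unfolding nn_integral_eliminate[OF v insert.prems(2) insert.prems(3) pos]
    by (simp add: nn_integral_elim_factor[OF pos])
qed

section \<open>Edge weights\<close>

text \<open>
  A path from \<open>R\<close> to \<open>\<delta>\<close> must leave \<open>R\<close>.
\<close>

lemma escape_if_connected:
  fixes E :: "'v set set"
  assumes conn: "connected_graph E" and W: "edge_weights E W" and R: "R \<noteq> {}" "\<delta> \<notin> R"
  shows "\<exists>i\<in>R. \<exists>j\<in>- R. 0 < W i j"
proof -
  obtain r where r: "r \<in> R" using R(1) by blast
  have "(r, \<delta>) \<in> {(x, y). {x, y} \<in> E}\<^sup>*" using conn by (simp add: connected_graph_def)
  then have "\<delta> \<in> R \<or> (\<exists>i\<in>R. \<exists>j\<in>- R. {i, j} \<in> E)"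
  proof (induction rule: rtrancl_induct)
    case base
    then show ?case using r by simp
  next
    case (step y z)
    then show ?case by blast
  qed
  then obtain i j where "i \<in> R" "j \<in> - R" "{i, j} \<in> E" using R(2) by blast
  then show ?thesis using W unfolding edge_weights_def by meson
qed

lemma edge_weights_nonneg: "edge_weights E W \<Longrightarrow> 0 \<le> W i j"
  unfolding edge_weights_def by (metis less_imp_le order_refl)

lemma edge_weights_sym: "edge_weights E W \<Longrightarrow> W i j = W j i"
  unfolding edge_weights_def by blast

lemma edge_weights_zero: "edge_weights E W \<Longrightarrow> {i, j} \<notin> E \<Longrightarrow> W i j = 0"
  unfolding edge_weights_def by meson

lemma edge_weights_diag:
  assumes "simple_graph E" "edge_weights E W"
  shows "W i i = 0"
proof -
  have "{i, i} \<notin> E" using assms(1) by (auto simp: simple_graph_def)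
  with assms(2) show ?thesis by (rule edge_weights_zero)
qed

lemma edge_weights_rescale:
  assumes "edge_weights E W" "\<And>i. 0 < a i"
  shows "edge_weights E (rescale a W)"
proof -
  have "rescale a W i j = rescale a W j i" for i j
    using edge_weights_sym[OF assms(1), of i j] by (simp add: rescale_def)
  moreover have "if {i, j} \<in> E then 0 < rescale a W i j else rescale a W i j = 0" for i j
  proof -
    have "if {i, j} \<in> E then 0 < W i j else W i j = 0"
      using assms(1) unfolding edge_weights_def by blast
    then show ?thesis
      using assms(2)[of i] assms(2)[of j] by (auto simp: rescale_def split: if_splits)
  qed
  ultimately show ?thesis unfolding edge_weights_def by blast
qed

section \<open>The density and its behaviour under scaling\<close>

lemma rho_eq_field_density:
  fixes E :: "'v::finite set set"
  assumes E: "simple_graph E" and W: "edge_weights E W"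
  shows "rho E \<delta> W (u, s) * (\<Prod>i\<in>UNIV - {\<delta>}. 1 / (2 * pi) * exp (- u i)) =
    field_density \<delta> (UNIV - {\<delta>}) W u s"
proof -
  have U: "insert \<delta> (UNIV - {\<delta>}) = UNIV" by auto
  have "A_mat W u = laplacian UNIV W u"
    by (intro ext) (simp add: A_mat_def laplacian_def edge_weights_diag[OF E W])
  moreover have "(\<Prod>e\<in>E. on_edge (\<lambda>i j.
        exp (- W i j * (cosh (u i - u j) - 1 + 1/2 * (s i - s j)\<^sup>2 * exp (u i + u j)))) e) =
      exp (- energy UNIV W u s)"
  proof (subst prod_on_edge_exp[OF E])
    show "- W i j * (cosh (u i - u j) - 1 + 1/2 * (s i - s j)\<^sup>2 * exp (u i + u j)) =
        - W j i * (cosh (u j - u i) - 1 + 1/2 * (s j - s i)\<^sup>2 * exp (u j + u i))" for i j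
      using cosh_minus[of "u i - u j"] edge_weights_sym[OF W, of i j]
      by (simp add: power2_commute add.commute)
  qed (simp_all add: edge_weights_zero[OF W] energy_def sum_negf)
  ultimately show ?thesis by (simp add: rho_def field_density_def U)
qed

text \<open>
  The transformation of the density under the inverse of the scaling map.  The conductances
  \<open>W i j * exp (u i + u j)\<close> are invariant, hence so is the determinant.  The energy changes by an
  amount that can be split, for each pair, into a part \<open>K i j\<close>, the reversed part \<open>K j i\<close>, and
  a constant; the row sums of \<open>K\<close> are the terms of the exponent of \<open>laplace_weight\<close>.  The
  row at \<open>\<delta>\<close> vanishes since \<open>a \<delta> = 1\<close> and \<open>b \<delta> = 0\<close>.
\<close>

lemma field_density_unscale:
  fixes E :: "'v::finite set set"
  assumes E: "simple_graph E" and W: "edge_weights E W" and G: "(a, b) \<in> G_set \<delta>"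
  shows "field_density \<delta> (UNIV - {\<delta>}) (rescale a W) (\<lambda>i. u i - ln (a i)) (\<lambda>i. s i + exp (- u i) * b i) =
    inverse (laplace_const E \<delta> W a b) * laplace_weight \<delta> W a b (u, s) * field_density \<delta> (UNIV - {\<delta>}) W u s"
proof -
  let ?u = "\<lambda>i. u i - ln (a i)" and ?s = "\<lambda>i. s i + exp (- u i) * b i"
  have a: "0 < a i" for i using G by (simp add: G_set_def)
  have U: "insert \<delta> (UNIV - {\<delta>}) = UNIV" by auto
  note sym = edge_weights_sym[OF W]
  have eu: "exp (?u i) = exp (u i) / a i" for i using a by (simp add: exp_diff)
  have w: "rescale a W i j * exp (?u i + ?u j) = W i j * exp (u i + u j)" for i j
    using a[of i] a[of j] unfolding exp_add eu by (simp add: rescale_def)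
  have lap: "laplacian UNIV (rescale a W) ?u = laplacian UNIV W u"
    unfolding laplacian_def w ..
  have prod: "(\<Prod>i\<in>UNIV - {\<delta>}. 1 / (2 * pi) * exp (- ?u i)) =
      (\<Prod>i\<in>UNIV - {\<delta>}. a i) * (\<Prod>i\<in>UNIV - {\<delta>}. 1 / (2 * pi) * exp (- u i))"
    unfolding prod.distrib[symmetric] exp_minus eu by (intro prod.cong) (auto simp: field_simps)
  \<comment> \<open>The exponent of the constant; each edge is counted twice in the double sum.\<close>
  define N where "N = (\<Sum>i\<in>UNIV. \<Sum>j\<in>UNIV. W i j * (a i * a j + b i * b j - 1))"
  define K where "K i j = 1/2 * W i j * ((a i)\<^sup>2 + (b i)\<^sup>2 - 1) * exp (u j - u i)
      + b i * (W i j * exp (u j) * (s i - s j))" for i j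
  have "rescale a W i j * (cosh (?u i - ?u j) - 1 + 1/2 * (?s i - ?s j)\<^sup>2 * exp (?u i + ?u j)) =
      W i j * (cosh (u i - u j) - 1 + 1/2 * (s i - s j)\<^sup>2 * exp (u i + u j))
      + K i j + K j i - W i j * (a i * a j + b i * b j - 1)" for i j
  proof -
    \<comment> \<open>In \<open>p\<close> and \<open>q\<close> the claim is an identity of rational functions.\<close>
    define p q where "p = exp (u i)" and "q = exp (u j)"
    have pq: "p \<noteq> 0" "q \<noteq> 0" by (simp_all add: p_def q_def)
    have a0: "a i \<noteq> 0" "a j \<noteq> 0" using a[of i] a[of j] by auto
    have 1: "a i * a j * w * (1/2 * (p / a i / (q / a j) + q / a j / (p / a i)) - 1
        + 1/2 * (x + b i / p - (y + b j / q))\<^sup>2 * (p / a i * (q / a j))) =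
      w * (1/2 * (p / q + q / p) - 1 + 1/2 * (x - y)\<^sup>2 * (p * q))
      + (1/2 * w * ((a i)\<^sup>2 + (b i)\<^sup>2 - 1) * (q / p) + b i * (w * q * (x - y)))
      + (1/2 * w * ((a j)\<^sup>2 + (b j)\<^sup>2 - 1) * (p / q) + b j * (w * p * (y - x)))
      - w * (a i * a j + b i * b j - 1)" for w x y :: real
      using pq a0 by (simp add: power2_eq_square field_simps)
    have 2: "cosh (u i - u j) = 1/2 * (p / q + q / p)"
      "cosh (?u i - ?u j) = 1/2 * (p / a i / (q / a j) + q / a j / (p / a i))"
      "?s i - ?s j = s i + b i / p - (s j + b j / q)"
      unfolding cosh_field_def minus_diff_eq exp_diff[of "u i" "u j"] exp_diff[of "u j" "u i"]
        exp_diff[of "?u i"] exp_diff[of "?u j"] eu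
      by (simp_all add: p_def q_def exp_minus field_simps)
    show ?thesis unfolding 2 unfolding K_def sym[of j i] exp_add exp_diff[of "u i" "u j"] exp_diff[of "u j" "u i"] eu
      unfolding p_def[symmetric] q_def[symmetric] rescale_def by (rule 1)
  qed
  then have "energy UNIV (rescale a W) ?u ?s = 1/2 * (\<Sum>i\<in>UNIV. \<Sum>j\<in>UNIV.
      W i j * (cosh (u i - u j) - 1 + 1/2 * (s i - s j)\<^sup>2 * exp (u i + u j))
      + K i j + K j i - W i j * (a i * a j + b i * b j - 1))" by (simp only: energy_def)
  also have "\<dots> = energy UNIV W u s + 1/2 * (\<Sum>i\<in>UNIV. \<Sum>j\<in>UNIV. K i j)
      + 1/2 * (\<Sum>i\<in>UNIV. \<Sum>j\<in>UNIV. K j i) - 1/2 * N"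
    by (simp only: energy_def N_def sum.distrib sum_subtractf right_diff_distrib distrib_left)
  \<comment> \<open>The reversed parts contribute the same as the \<open>K i j\<close>, so the factor 1/2 disappears.\<close>
  also have "(\<Sum>i\<in>UNIV. \<Sum>j\<in>UNIV. K j i) = (\<Sum>i\<in>UNIV. \<Sum>j\<in>UNIV. K i j)" by (rule sum.swap)
  finally have en: "energy UNIV (rescale a W) ?u ?s =
      energy UNIV W u s + (\<Sum>i\<in>UNIV. \<Sum>j\<in>UNIV. K i j) - 1/2 * N" by simp
  have Ki: "(\<Sum>j\<in>UNIV. K i j) = ((a i)\<^sup>2 + (b i)\<^sup>2 - 1) * beta W u i + b i * theta W u s i" for i
    unfolding K_def beta_def theta_def sum.distrib sum_distrib_left by (simp add: mult_ac)
  have "(\<Sum>i\<in>UNIV. \<Sum>j\<in>UNIV. K i j) =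
      (\<Sum>i\<in>UNIV - {\<delta>}. ((a i)\<^sup>2 + (b i)\<^sup>2 - 1) * beta W u i + b i * theta W u s i)"
    unfolding Ki using G by (intro sum.mono_neutral_right) (auto simp: G_set_def)
  then have lw: "laplace_weight \<delta> W a b (u, s) = exp (- (\<Sum>i\<in>UNIV. \<Sum>j\<in>UNIV. K i j))"
    by (simp add: laplace_weight_def sum.distrib)
  have lc: "laplace_const E \<delta> W a b = exp (- (1/2 * N)) * inverse (\<Prod>i\<in>UNIV - {\<delta>}. a i)"
  proof -
    have "(\<Prod>e\<in>E. on_edge (\<lambda>i j. exp (- W i j * (a i * a j + b i * b j - 1))) e) = exp (- (1/2 * N))"
    proof (subst prod_on_edge_exp[OF E])
      show "- W i j * (a i * a j + b i * b j - 1) = - W j i * (a j * a i + b j * b i - 1)" for i j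
        using sym[of i j] by (simp add: mult.commute)
    qed (simp_all add: edge_weights_zero[OF W] N_def sum_negf)
    moreover have "(\<Prod>j\<in>UNIV - {\<delta>}. 1 / a j) = inverse (\<Prod>i\<in>UNIV - {\<delta>}. a i)"
      by (simp add: prod_dividef inverse_eq_divide)
    ultimately show ?thesis by (simp add: laplace_const_def)
  qed
  have "exp (- energy UNIV (rescale a W) ?u ?s) =
      exp (1/2 * N) * exp (- (\<Sum>i\<in>UNIV. \<Sum>j\<in>UNIV. K i j)) * exp (- energy UNIV W u s)"
    unfolding en by (simp add: exp_add[symmetric])
  moreover have "inverse (laplace_const E \<delta> W a b) = exp (1/2 * N) * (\<Prod>i\<in>UNIV - {\<delta>}. a i)"
    unfolding lc by (simp add: exp_minus)
  ultimately show ?thesis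
    unfolding field_density_def U lap prod lw by (simp only: mult_ac)
qed

section \<open>The pinned reference measure\<close>

lemma measurable_pinned_translate:
  fixes c :: "'v::finite \<Rightarrow> real"
  shows "(\<lambda>u i. u i + c i) \<in> measurable (pinned_lborel \<delta>) (pinned_lborel \<delta>)"
proof -
  have "(\<lambda>u i. u i + c i) \<in> borel_measurable borel"
    by (intro borel_measurable_continuous_onI continuous_on_coordinatewise_then_product continuous_intros
        continuous_on_product_coordinates)
  then show ?thesis by (simp cong: measurable_cong_sets add: sets_pinned_lborel)
qed

lemma pinned_lborel_translate:
  fixes c :: "'v::finite \<Rightarrow> real"
  assumes c: "c \<delta> = 0"
  shows "distr (pinned_lborel \<delta>) (pinned_lborel \<delta>) (\<lambda>u i. u i + c i) = pinned_lborel \<delta>"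
proof -
  let ?M = "pinned_family \<delta>"
  interpret product_sigma_finite ?M by (rule product_sigma_finite_pinned)
  have meas: "(\<lambda>u i. u i + c i) \<in> measurable (PiM UNIV ?M) (PiM UNIV ?M)"
    using measurable_pinned_translate[of c \<delta>] by (simp only: pinned_lborel_def)
  have "distr (PiM UNIV ?M) (PiM UNIV ?M) (\<lambda>u i. u i + c i) = PiM UNIV ?M"
  proof (rule PiM_eqI)
    fix A :: "'v \<Rightarrow> real set" assume A: "\<And>i. i \<in> UNIV \<Longrightarrow> A i \<in> sets (?M i)"
    have pre: "(\<lambda>x. x + c i) -` A i \<in> sets (?M i)
        \<and> emeasure (?M i) ((\<lambda>x. x + c i) -` A i) = emeasure (?M i) (A i)" for i
    proof (cases "i = \<delta>")
      case True
      then show ?thesis using A[of i] c by simp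
    next
      case False
      then have Ai: "A i \<in> sets borel" using A[of i] by simp
      have "(\<lambda>x. x + c i) -` A i \<in> sets borel"
        using measurable_sets[OF _ Ai, of "\<lambda>x. x + c i" borel] by simp
      moreover have "emeasure lborel ((\<lambda>x. x + c i) -` A i) = emeasure (distr lborel borel ((+) (c i))) (A i)"
        using Ai by (simp add: emeasure_distr add.commute[of _ "c i"] vimage_def)
      ultimately show ?thesis using False by (simp add: lborel_distr_plus)
    qed
    have "emeasure (distr (PiM UNIV ?M) (PiM UNIV ?M) (\<lambda>u i. u i + c i)) (PiE UNIV A) =
        emeasure (PiM UNIV ?M) ((\<lambda>u i. u i + c i) -` PiE UNIV A \<inter> space (PiM UNIV ?M))"
      using A by (intro emeasure_distr meas sets_PiM_I_finite) auto
    also have "(\<lambda>u i. u i + c i) -` PiE UNIV A \<inter> space (PiM UNIV ?M) =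
        PiE UNIV (\<lambda>i. (\<lambda>x. x + c i) -` A i)"
      by (auto simp: space_PiM PiE_def Pi_def)
    also have "emeasure (PiM UNIV ?M) \<dots> = (\<Prod>i\<in>UNIV. emeasure (?M i) ((\<lambda>x. x + c i) -` A i))"
      using pre by (intro emeasure_PiM) auto
    finally show "emeasure (distr (PiM UNIV ?M) (PiM UNIV ?M) (\<lambda>u i. u i + c i)) (PiE UNIV A) =
        (\<Prod>i\<in>UNIV. emeasure (?M i) (A i))" using pre by simp
  qed simp_all
  then show ?thesis by (simp add: pinned_lborel_def)
qed

lemma nn_integral_pinned_translate:
  fixes c :: "'v::finite \<Rightarrow> real"
  assumes "c \<delta> = 0" and "f \<in> borel_measurable (pinned_lborel \<delta>)"
  shows "(\<integral>\<^sup>+u. f (\<lambda>i. u i + c i) \<partial>pinned_lborel \<delta>) = (\<integral>\<^sup>+u. f u \<partial>pinned_lborel \<delta>)"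
  using nn_integral_distr[OF measurable_pinned_translate[of c \<delta>], of f] assms(2)
  unfolding pinned_lborel_translate[of c, OF assms(1)] by simp

text \<open>
  The scaling map translates \<open>u\<close> by a constant, and \<open>s\<close> by an amount that depends on \<open>u\<close> only.
  Such a map preserves the reference measure, provided that it fixes the coordinates at \<open>\<delta>\<close>.
\<close>

lemma nn_integral_pinned_shear:
  fixes c :: "'v::finite \<Rightarrow> real"
  assumes "c \<delta> = 0" and "\<And>u. d u \<delta> = 0"
    and F: "(\<lambda>(u, s). F u s) \<in> borel_measurable (pinned_lborel \<delta> \<Otimes>\<^sub>M pinned_lborel \<delta>)"
  shows "(\<integral>\<^sup>+u. \<integral>\<^sup>+s. F (\<lambda>i. u i + c i) (\<lambda>i. s i + d u i) \<partial>pinned_lborel \<delta> \<partial>pinned_lborel \<delta>) =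
    (\<integral>\<^sup>+u. \<integral>\<^sup>+s. F u s \<partial>pinned_lborel \<delta> \<partial>pinned_lborel \<delta>)"
proof -
  interpret product_sigma_finite "pinned_family \<delta>" by (rule product_sigma_finite_pinned)
  interpret sigma_finite_measure "pinned_lborel \<delta>"
    unfolding pinned_lborel_def by (rule sigma_finite) simp
  have sp: "space (pinned_lborel \<delta>) = UNIV"
    using sets_eq_imp_space_eq[OF sets_pinned_lborel, of \<delta>] by simp
  have Fu: "F u \<in> borel_measurable (pinned_lborel \<delta>)" for u
    using measurable_Pair2[OF F, of u] sp by simp
  have "(\<integral>\<^sup>+u. \<integral>\<^sup>+s. F (\<lambda>i. u i + c i) (\<lambda>i. s i + d u i) \<partial>pinned_lborel \<delta> \<partial>pinned_lborel \<delta>) =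
      (\<integral>\<^sup>+u. (\<lambda>u. \<integral>\<^sup>+s. F u s \<partial>pinned_lborel \<delta>) (\<lambda>i. u i + c i) \<partial>pinned_lborel \<delta>)"
    by (intro nn_integral_cong nn_integral_pinned_translate Fu assms(2))
  also have "\<dots> = (\<integral>\<^sup>+u. \<integral>\<^sup>+s. F u s \<partial>pinned_lborel \<delta> \<partial>pinned_lborel \<delta>)"
    by (rule nn_integral_pinned_translate[where c=c, OF assms(1)])
      (rule borel_measurable_nn_integral[OF F])
  finally show ?thesis .
qed

lemma AE_pinned_lborel: "AE u in pinned_lborel \<delta>. u \<delta> = 0"
proof -
  let ?M = "pinned_family \<delta>"
  \<comment> \<open>The exceptional set is a box whose factor at \<open>\<delta>\<close> has Dirac mass 0.\<close>
  let ?A = "\<lambda>i. if i = \<delta> then - {0::real} else UNIV"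
  interpret product_sigma_finite ?M by (rule product_sigma_finite_pinned)
  have "emeasure (PiM UNIV ?M) (PiE UNIV ?A) = (\<Prod>i\<in>UNIV. emeasure (?M i) (?A i))"
    by (intro emeasure_PiM) auto
  also have "\<dots> = 0" by (intro prod_zero) (auto intro!: bexI[of _ \<delta>])
  finally have "emeasure (pinned_lborel \<delta>) (PiE UNIV ?A) = 0" by (simp add: pinned_lborel_def)
  moreover have "PiE UNIV ?A \<in> sets (pinned_lborel \<delta>)"
    unfolding pinned_lborel_def by (intro sets_PiM_I_finite) auto
  ultimately show ?thesis
    by (intro AE_I[of _ _ "PiE UNIV ?A"]) (auto simp: PiE_def Pi_def)
qed

section \<open>The probability measure\<close>

lemma continuous_on_coordinates:
  shows "continuous_on UNIV (\<lambda>x :: ('v \<Rightarrow> real) \<times> ('v \<Rightarrow> real). fst x i)"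
    and "continuous_on UNIV (\<lambda>x :: ('v \<Rightarrow> real) \<times> ('v \<Rightarrow> real). snd x i)"
  by (rule continuous_on_compose2[OF continuous_on_product_coordinates];
      simp add: continuous_on_fst continuous_on_snd continuous_on_id)+

lemma Omega_in_borel: "Omega (\<delta> :: 'v) \<in> sets borel"
proof -
  have "closed {x :: ('v \<Rightarrow> real) \<times> ('v \<Rightarrow> real). fst x \<delta> = 0 \<and> snd x \<delta> = 0}"
    by (intro closed_Collect_conj closed_Collect_eq continuous_on_const continuous_on_coordinates)
  also have "{x :: ('v \<Rightarrow> real) \<times> ('v \<Rightarrow> real). fst x \<delta> = 0 \<and> snd x \<delta> = 0} = Omega \<delta>"
    by (auto simp: Omega_def)
  finally show ?thesis by (rule borel_closed)
qed

lemma sets_pinned_pair: "sets (pinned_lborel \<delta> \<Otimes>\<^sub>M pinned_lborel \<delta>) = sets borel"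
  using sets_pair_measure_cong[OF sets_pinned_lborel sets_pinned_lborel] unfolding borel_prod .

lemma borel_measurable_field_density_pair:
  fixes \<delta> :: "'v::finite"
  shows "(\<lambda>(u, s). field_density \<delta> (UNIV - {\<delta>}) W u s) \<in> borel_measurable borel"
proof -
  show ?thesis unfolding case_prod_beta
    by (intro borel_measurable_field_density borel_measurable_const borel_measurable_continuous_onI
        continuous_on_coordinates)
qed

lemma nn_integral_mu:
  fixes E :: "'v::finite set set"
  assumes E: "simple_graph E" and W: "edge_weights E W"
    and h: "h \<in> borel_measurable (Omega_borel \<delta>)"
  shows "(\<integral>\<^sup>+x. h x \<partial>mu E \<delta> W) = (\<integral>\<^sup>+u. \<integral>\<^sup>+s. ennreal (field_density \<delta> (UNIV - {\<delta>}) W u s) *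
    (h (u, s) * indicator (Omega \<delta>) (u, s)) \<partial>pinned_lborel \<delta> \<partial>pinned_lborel \<delta>)"
proof -
  let ?P = "pinned_lborel \<delta>"
  let ?g = "\<lambda>(u, s). ennreal (field_density \<delta> (UNIV - {\<delta>}) W u s)"
  interpret product_sigma_finite "pinned_family \<delta>" by (rule product_sigma_finite_pinned)
  interpret sigma_finite_measure ?P
    unfolding pinned_lborel_def by (rule sigma_finite) simp
  have mu: "mu E \<delta> W = restrict_space (density (?P \<Otimes>\<^sub>M ?P) ?g) (Omega \<delta>)"
    unfolding mu_def rho_eq_field_density[OF E W] ..
  have sp: "space (?P \<Otimes>\<^sub>M ?P) = UNIV"
    using sets_eq_imp_space_eq[OF sets_pinned_pair, of \<delta>] by simp
  have g: "?g \<in> borel_measurable (?P \<Otimes>\<^sub>M ?P)"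
    using measurable_compose[OF borel_measurable_field_density_pair[of \<delta> W] measurable_ennreal]
    by (simp add: case_prod_beta sets_pinned_pair cong: measurable_cong_sets)
  have hI: "(\<lambda>x. h x * indicator (Omega \<delta>) x) \<in> borel_measurable (?P \<Otimes>\<^sub>M ?P)"
    using h Omega_in_borel[of \<delta>]
    by (simp add: borel_measurable_restrict_space_iff_ennreal sets_pinned_pair cong: measurable_cong_sets)
  have "(\<integral>\<^sup>+x. h x \<partial>mu E \<delta> W) = (\<integral>\<^sup>+x. h x * indicator (Omega \<delta>) x \<partial>density (?P \<Otimes>\<^sub>M ?P) ?g)"
    unfolding mu using Omega_in_borel[of \<delta>]
    by (intro nn_integral_restrict_space) (simp add: sp sets_pinned_pair)
  also have "\<dots> = (\<integral>\<^sup>+x. ?g x * (h x * indicator (Omega \<delta>) x) \<partial>(?P \<Otimes>\<^sub>M ?P))"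
    by (rule nn_integral_density[OF g hI])
  also have "\<dots> = (\<integral>\<^sup>+u. \<integral>\<^sup>+s. ?g (u, s) * (h (u, s) * indicator (Omega \<delta>) (u, s)) \<partial>?P \<partial>?P)"
    by (rule nn_integral_fst[symmetric]) (rule borel_measurable_times_ennreal[OF g hI])
  finally show ?thesis by simp
qed

lemma prob_space_mu:
  fixes E :: "'v::finite set set"
  assumes E: "simple_graph E" and conn: "connected_graph E" and W: "edge_weights E W"
  shows "prob_space (mu E \<delta> W)"
proof
  let ?P = "pinned_lborel \<delta>"
  have U: "insert \<delta> (UNIV - {\<delta>}) = UNIV" by auto
  have "emeasure (mu E \<delta> W) (space (mu E \<delta> W)) = (\<integral>\<^sup>+x. 1 \<partial>mu E \<delta> W)" by simp
  also have "\<dots> = (\<integral>\<^sup>+u. \<integral>\<^sup>+s. ennreal (field_density \<delta> (UNIV - {\<delta>}) W u s) *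
      (1 * indicator (Omega \<delta>) (u, s)) \<partial>?P \<partial>?P)"
    by (intro nn_integral_mu E W) simp
  also have "\<dots> = (\<integral>\<^sup>+u. \<integral>\<^sup>+s. ennreal (field_density \<delta> (UNIV - {\<delta>}) W u s) \<partial>?P \<partial>?P)"
  proof (rule nn_integral_cong_AE, use AE_pinned_lborel in eventually_elim)
    case (elim u)
    show ?case
      by (rule nn_integral_cong_AE, use AE_pinned_lborel[of \<delta>] in eventually_elim)
        (use elim in \<open>simp add: Omega_def\<close>)
  qed
  also have "\<dots> = 1"
  proof -
    have "\<exists>i\<in>R. \<exists>j\<in>insert \<delta> (UNIV - {\<delta>}) - R. 0 < W i j"
      if "R \<subseteq> UNIV - {\<delta>}" "R \<noteq> {}" for R
      using escape_if_connected[OF conn W, of R \<delta>] that unfolding U Compl_eq_Diff_UNIV by blast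
    then show ?thesis
      using nn_integral_field_density[of \<delta> "UNIV - {\<delta>}" W] edge_weights_nonneg[OF W] edge_weights_sym[OF W]
      unfolding U pinned_lborel_def by simp
  qed
  finally show "emeasure (mu E \<delta> W) (space (mu E \<delta> W)) = 1" .
qed

section \<open>The image of the measure under scaling\<close>

lemma scaling_mem_Omega:
  assumes "(a, b) \<in> G_set \<delta>"
  shows "scaling a b x \<in> Omega \<delta> \<longleftrightarrow> x \<in> Omega \<delta>"
  using assms by (cases x) (simp add: scaling_def Omega_def G_set_def)

lemma measurable_scaling:
  fixes \<delta> :: "'v::finite"
  assumes "(a, b) \<in> G_set \<delta>"
  shows "scaling a b \<in> measurable (Omega_borel \<delta>) (Omega_borel \<delta>)"
proof -
  have "0 < a i" for i using assms by (simp add: G_set_def)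
  then have a0: "a i \<noteq> 0" for i by (simp add: less_imp_neq[symmetric])
  have "scaling a b \<in> borel_measurable borel"
    unfolding scaling_def case_prod_beta
    by (intro borel_measurable_continuous_onI continuous_on_Pair continuous_on_coordinatewise_then_product
        continuous_on_add continuous_on_diff continuous_on_divide continuous_on_mult continuous_on_exp
        continuous_on_minus continuous_on_const continuous_on_coordinates) (use a0 in auto)
  then show ?thesis
    by (intro measurable_restrict_space3) (auto simp: scaling_mem_Omega[OF assms])
qed

lemma borel_measurable_laplace_weight:
  fixes \<delta> :: "'v::finite"
  shows "laplace_weight \<delta> W a b \<in> borel_measurable borel"
proof -
  show ?thesis
    unfolding laplace_weight_def beta_def theta_def case_prod_beta
    by (intro borel_measurable_continuous_onI continuous_on_exp continuous_on_diff continuous_on_minus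
        continuous_on_sum continuous_on_mult continuous_on_const continuous_on_coordinates)
qed

lemma laplace_const_pos:
  fixes E :: "'v::finite set set"
  assumes E: "simple_graph E" and W: "edge_weights E W" and a: "\<And>i. 0 < a i"
  shows "0 < laplace_const E \<delta> W a b"
proof -
  have "on_edge (\<lambda>i j. exp (- W i j * (a i * a j + b i * b j - 1))) e > 0" if "e \<in> E" for e
  proof -
    have "card e = 2" using E that by (simp add: simple_graph_def)
    then obtain i j where e: "e = {i, j}" by (auto simp: card_2_iff)
    have "on_edge (\<lambda>i j. exp (- W i j * (a i * a j + b i * b j - 1))) {i, j} =
        exp (- W i j * (a i * a j + b i * b j - 1))"
    proof (rule on_edge_eq)
      show "exp (- W i j * (a i * a j + b i * b j - 1)) = exp (- W j i * (a j * a i + b j * b i - 1))" for i j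
        using edge_weights_sym[OF W, of i j] by (simp add: mult.commute)
    qed
    then show ?thesis unfolding e by simp
  qed
  then show ?thesis unfolding laplace_const_def using a by (intro mult_pos_pos prod_pos) auto
qed

text \<open>
  The heart of the scaling relation: the change of variables by \<open>scaling a b\<close>, combined with the
  transformation of the density in \<open>field_density_unscale\<close>.
\<close>

lemma nn_integral_mu_scaling:
  fixes E :: "'v::finite set set"
  assumes E: "simple_graph E" and W: "edge_weights E W" and G: "(a, b) \<in> G_set \<delta>"
    and h: "h \<in> borel_measurable (Omega_borel \<delta>)"
  shows "(\<integral>\<^sup>+x. h (scaling a b x) \<partial>mu E \<delta> (rescale a W)) =
    (\<integral>\<^sup>+x. ennreal (inverse (laplace_const E \<delta> W a b) * laplace_weight \<delta> W a b x) * h x \<partial>mu E \<delta> W)"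
proof -
  let ?P = "pinned_lborel \<delta>"
  let ?D = "\<lambda>W u s. ennreal (field_density \<delta> (UNIV - {\<delta>}) W u s)"
  let ?w = "\<lambda>x. inverse (laplace_const E \<delta> W a b) * laplace_weight \<delta> W a b x"
  let ?h = "\<lambda>x. h x * indicator (Omega \<delta>) x"
  have a: "0 < a i" for i using G by (simp add: G_set_def)
  have w: "0 \<le> ?w x" for x
    using laplace_const_pos[where a=a and b=b and \<delta>=\<delta>, OF E W a] by (cases x) (simp add: laplace_weight_def)
  \<comment> \<open>\<open>F\<close> is the integrand on the right-hand side, to be evaluated at the scaled fields.\<close>
  define F where "F u s = ?D W u s * (ennreal (?w (u, s)) * ?h (u, s))" for u s
  have F_unscale: "F u s = ?D (rescale a W) (\<lambda>i. u i - ln (a i)) (\<lambda>i. s i + exp (- u i) * b i) * ?h (u, s)" for u s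
    unfolding F_def field_density_unscale[OF E W G] ennreal_mult'[OF w] by (simp only: mult_ac)
  have hI: "?h \<in> borel_measurable borel"
    using h Omega_in_borel[of \<delta>] by (simp add: borel_measurable_restrict_space_iff_ennreal)
  have wm: "(\<lambda>x. ennreal (?w x)) \<in> borel_measurable borel"
    using borel_measurable_laplace_weight by measurable
  have F: "(\<lambda>(u, s). F u s) \<in> borel_measurable (?P \<Otimes>\<^sub>M ?P)"
  proof -
    have "(\<lambda>x. (case x of (u, s) \<Rightarrow> ?D W u s) * (ennreal (?w x) * ?h x)) \<in> borel_measurable borel"
      using measurable_compose[OF borel_measurable_field_density_pair[of \<delta> W] measurable_ennreal]
      by (intro borel_measurable_times_ennreal wm hI) (simp add: case_prod_beta)
    also have "(\<lambda>x. (case x of (u, s) \<Rightarrow> ?D W u s) * (ennreal (?w x) * ?h x)) = (\<lambda>(u, s). F u s)"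
      by (auto simp: F_def)
    finally show ?thesis by (simp add: sets_pinned_pair cong: measurable_cong_sets)
  qed
  have "(\<integral>\<^sup>+x. h (scaling a b x) \<partial>mu E \<delta> (rescale a W)) =
      (\<integral>\<^sup>+u. \<integral>\<^sup>+s. ?D (rescale a W) u s * (h (scaling a b (u, s)) * indicator (Omega \<delta>) (u, s)) \<partial>?P \<partial>?P)"
    by (intro nn_integral_mu E edge_weights_rescale W a measurable_compose[OF measurable_scaling[OF G] h])
  also have "\<dots> = (\<integral>\<^sup>+u. \<integral>\<^sup>+s. F (\<lambda>i. u i + ln (a i)) (\<lambda>i. s i + - (exp (- u i) * b i / a i)) \<partial>?P \<partial>?P)"
  proof (intro nn_integral_cong)
    fix u s
    have sc: "scaling a b (u, s) = (\<lambda>i. u i + ln (a i), \<lambda>i. s i + - (exp (- u i) * b i / a i))"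
      by (simp add: scaling_def)
    have "(\<lambda>i. s i + - (exp (- u i) * b i / a i) + exp (- (u i + ln (a i))) * b i) = s"
    proof
      fix i
      have "exp (- (u i + ln (a i))) = exp (- u i) / a i"
        using a[of i] by (simp add: exp_diff)
      then show "s i + - (exp (- u i) * b i / a i) + exp (- (u i + ln (a i))) * b i = s i" by simp
    qed
    then show "?D (rescale a W) u s * (h (scaling a b (u, s)) * indicator (Omega \<delta>) (u, s)) =
        F (\<lambda>i. u i + ln (a i)) (\<lambda>i. s i + - (exp (- u i) * b i / a i))"
      unfolding F_unscale sc[symmetric] by (simp add: scaling_mem_Omega[OF G] indicator_def)
  qed
  also have "\<dots> = (\<integral>\<^sup>+u. \<integral>\<^sup>+s. F u s \<partial>?P \<partial>?P)"
    using G by (intro nn_integral_pinned_shear F) (auto simp: G_set_def)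
  also have "\<dots> = (\<integral>\<^sup>+x. ennreal (?w x) * h x \<partial>mu E \<delta> W)"
  proof -
    have "(\<lambda>x. ennreal (?w x) * h x) \<in> borel_measurable (Omega_borel \<delta>)"
      by (intro borel_measurable_times_ennreal h measurable_restrict_space1 wm)
    from nn_integral_mu[OF E W this] show ?thesis by (simp add: F_def mult.assoc)
  qed
  finally show ?thesis .
qed

theorem theorem1p1:
  fixes E :: "'v::finite set set" and \<delta> :: 'v and W :: "'v \<Rightarrow> 'v \<Rightarrow> real"
    and a b :: "'v \<Rightarrow> real"
  assumes "simple_graph E" and "connected_graph E" and "edge_weights E W"
    and "(a, b) \<in> G_set \<delta>"
  shows
    "absolutely_continuous (mu E \<delta> W)
       (distr (mu E \<delta> (rescale a W)) (Omega_borel \<delta>) (scaling a b)) \<and>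
     (AE x in mu E \<delta> W.
        RN_deriv (mu E \<delta> W)
          (distr (mu E \<delta> (rescale a W)) (Omega_borel \<delta>) (scaling a b)) x =
        ennreal (inverse (laplace_const E \<delta> W a b) * laplace_weight \<delta> W a b x)) \<and>
     distr (mu E \<delta> (rescale a W)) (Omega_borel \<delta>) (scaling a b) =
       density (mu E \<delta> W)
         (\<lambda>x. ennreal (inverse (laplace_const E \<delta> W a b) * laplace_weight \<delta> W a b x)) \<and>
     (\<forall>f :: ('v \<Rightarrow> real) \<times> ('v \<Rightarrow> real) \<Rightarrow> real.
        f \<in> borel_measurable (Omega_borel \<delta>) \<longrightarrow> (\<forall>x\<in>Omega \<delta>. 0 \<le> f x) \<longrightarrow>
        (\<integral>\<^sup>+x. ennreal (f x * laplace_weight \<delta> W a b x) \<partial>mu E \<delta> W) =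
          ennreal (laplace_const E \<delta> W a b) *
          (\<integral>\<^sup>+x. ennreal (f (scaling a b x)) \<partial>mu E \<delta> (rescale a W))) \<and>
     integrable (mu E \<delta> W) (laplace_weight \<delta> W a b) \<and>
     laplace_const E \<delta> W a b = (\<integral>x. laplace_weight \<delta> W a b x \<partial>mu E \<delta> W)"
proof -
  note E = assms(1) and conn = assms(2) and W = assms(3) and G = assms(4)
  let ?L = "laplace_const E \<delta> W a b" and ?l = "laplace_weight \<delta> W a b"
  let ?\<mu> = "mu E \<delta> W" and ?\<nu> = "mu E \<delta> (rescale a W)"
  let ?w = "\<lambda>x. ennreal (inverse ?L * ?l x)"
  have a: "0 < a i" for i using G by (simp add: G_set_def)
  interpret \<mu>: prob_space ?\<mu> by (rule prob_space_mu[OF E conn W])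
  interpret \<nu>: prob_space ?\<nu> by (rule prob_space_mu[OF E conn edge_weights_rescale[OF W a]])
  have L: "0 < ?L" by (rule laplace_const_pos[OF E W a])
  have l: "0 < ?l x" for x by (cases x) (simp add: laplace_weight_def)
  have cong: "f \<in> borel_measurable (mu E \<delta> V) \<longleftrightarrow> f \<in> borel_measurable (Omega_borel \<delta>)"
    for V and f :: "_ \<Rightarrow> 'z::topological_space"
    by (intro arg_cong2[where f="(\<in>)"] refl measurable_cong_sets sets_mu)
  have lm: "?l \<in> borel_measurable ?\<mu>"
    unfolding cong by (rule measurable_restrict_space1[OF borel_measurable_laplace_weight])
  then have wm: "?w \<in> borel_measurable ?\<mu>" by measurable
  have scm: "scaling a b \<in> measurable ?\<nu> (Omega_borel \<delta>)"
    using measurable_scaling[OF G] by (simp add: measurable_cong_sets[OF sets_mu refl])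
  have eq: "distr ?\<nu> (Omega_borel \<delta>) (scaling a b) = density ?\<mu> ?w"
  proof (rule measure_eqI)
    show "sets (distr ?\<nu> (Omega_borel \<delta>) (scaling a b)) = sets (density ?\<mu> ?w)"
      by (simp add: sets_mu)
  next
    fix A assume A': "A \<in> sets (distr ?\<nu> (Omega_borel \<delta>) (scaling a b))"
    then have A: "A \<in> sets (Omega_borel \<delta>)" by simp
    have "emeasure (distr ?\<nu> (Omega_borel \<delta>) (scaling a b)) A =
        (\<integral>\<^sup>+x. indicator A x \<partial>distr ?\<nu> (Omega_borel \<delta>) (scaling a b))"
      by (rule nn_integral_indicator[OF A', symmetric])
    also have "\<dots> = (\<integral>\<^sup>+x. indicator A (scaling a b x) \<partial>?\<nu>)"
      by (rule nn_integral_distr[OF scm borel_measurable_indicator[OF A']])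
    also have "\<dots> = (\<integral>\<^sup>+x. ?w x * indicator A x \<partial>?\<mu>)"
      using A by (intro nn_integral_mu_scaling E W G borel_measurable_indicator)
    also have "\<dots> = emeasure (density ?\<mu> ?w) A"
      using A by (intro emeasure_density[symmetric] wm) (simp add: sets_mu)
    finally show "emeasure (distr ?\<nu> (Omega_borel \<delta>) (scaling a b)) A = emeasure (density ?\<mu> ?w) A" .
  qed
  have transform: "(\<integral>\<^sup>+x. ennreal (f x * ?l x) \<partial>?\<mu>) = ennreal ?L * (\<integral>\<^sup>+x. ennreal (f (scaling a b x)) \<partial>?\<nu>)"
    if f: "f \<in> borel_measurable (Omega_borel \<delta>)" for f
  proof -
    have fm: "(\<lambda>x. ennreal (f x)) \<in> borel_measurable (Omega_borel \<delta>)" using f by measurable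
    have "ennreal (f x * ?l x) = ennreal ?L * (?w x * ennreal (f x))" for x
    proof -
      have "ennreal ?L * ?w x = ennreal (?L * (inverse ?L * ?l x))"
        using L by (simp only: ennreal_mult' less_imp_le)
      moreover have "?L * (inverse ?L * ?l x) = ?l x" using L by simp
      ultimately have 1: "ennreal ?L * ?w x = ennreal (?l x)" by (simp only:)
      have "ennreal (f x * ?l x) = ennreal (?l x) * ennreal (f x)"
        by (subst mult.commute) (rule ennreal_mult'[OF less_imp_le[OF l]])
      also have "\<dots> = ennreal ?L * (?w x * ennreal (f x))"
        unfolding 1[symmetric] by (rule mult.assoc)
      finally show ?thesis .
    qed
    then have "(\<integral>\<^sup>+x. ennreal (f x * ?l x) \<partial>?\<mu>) = (\<integral>\<^sup>+x. ennreal ?L * (?w x * ennreal (f x)) \<partial>?\<mu>)" by simp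
    also have "\<dots> = ennreal ?L * (\<integral>\<^sup>+x. ?w x * ennreal (f x) \<partial>?\<mu>)"
      using fm by (intro nn_integral_cmult borel_measurable_times_ennreal wm) (simp add: cong)
    also have "(\<integral>\<^sup>+x. ?w x * ennreal (f x) \<partial>?\<mu>) = (\<integral>\<^sup>+x. ennreal (f (scaling a b x)) \<partial>?\<nu>)"
      by (rule nn_integral_mu_scaling[OF E W G fm, symmetric])
    finally show ?thesis .
  qed
  \<comment> \<open>Here the normalisation of the measure with weights \<open>rescale a W\<close> enters.\<close>
  have total: "(\<integral>\<^sup>+x. ennreal (?l x) \<partial>?\<mu>) = ennreal ?L"
    using transform[of "\<lambda>_. 1"] \<nu>.emeasure_space_1 by simp
  have int: "integrable ?\<mu> ?l"
    using lm l by (intro integrableI_nonneg) (auto simp: total less_imp_le)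
  have "ennreal (\<integral>x. ?l x \<partial>?\<mu>) = ennreal ?L"
    using nn_integral_eq_integral[OF int] l total by (simp add: less_imp_le)
  then have const: "?L = (\<integral>x. ?l x \<partial>?\<mu>)"
    using L l by (simp add: integral_nonneg_AE less_imp_le)
  have ac: "absolutely_continuous ?\<mu> (distr ?\<nu> (Omega_borel \<delta>) (scaling a b))"
    unfolding eq by (rule absolutely_continuousI_density[OF wm])
  \<comment> \<open>Densities are unique because \<open>mu E \<delta> W\<close> is a finite measure.\<close>
  have rn: "AE x in ?\<mu>. RN_deriv ?\<mu> (distr ?\<nu> (Omega_borel \<delta>) (scaling a b)) x = ?w x"
    using \<mu>.RN_deriv_unique[OF wm eq[symmetric]] by eventually_elim simp
  show ?thesis using ac rn eq transform int const by blast
qed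

end
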